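(* Let $H$ be a graph on $\{1,\ldots,h\}$ with $m$ edges. Let $\epsilon>0$ and let $\delta^{-1}$ be a tower of twos of height $\lceil 8h^4\log_2 \epsilon^{-1}\rceil$. If $G$ is a graph on $n$ vertices in which at least $\epsilon n^2$ edges need to be removed to make it $H$-free, then $G$ contains at least $\delta n^h$ copies of $H$.
   Context: Graphs are finite, simple and undirected. A copy of $H$ in $G$ is a (not necessarily induced) subgraph of $G$ isomorphic to $H$, and a graph is $H$-free if it contains no copy of $H$. The tower of twos of height $i$ is $T(i)$, where $T(1)=2$ and $T(i+1)=2^{T(i)}$ for $i\ge 1$; set $T(i)=1$ for $i\le 0$ (this occurs only for $\epsilon\geq 1$, when the hypothesis on $G$ cannot hold for $n\ge1$ unless $H$ has no edges). *)

theory Defs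
  imports Complex_Main
begin

type_synonym 'a ugraph = "'a set \<times> 'a set set"

abbreviation verts :: "'a ugraph \<Rightarrow> 'a set" where
  "verts G \<equiv> fst G"

abbreviation edges :: "'a ugraph \<Rightarrow> 'a set set" where
  "edges G \<equiv> snd G"

definition simple_graph :: "'a ugraph \<Rightarrow> bool" where
  "simple_graph G \<longleftrightarrow> finite (verts G) \<and> (\<forall>e\<in>edges G. e \<subseteq> verts G \<and> card e = 2)"

definition subgraph :: "'a ugraph \<Rightarrow> 'a ugraph \<Rightarrow> bool" where
  "subgraph K G \<longleftrightarrow> simple_graph K \<and> verts K \<subseteq> verts G \<and> edges K \<subseteq> edges G"

definition graph_iso :: "'a ugraph \<Rightarrow> 'b ugraph \<Rightarrow> bool" where
  "graph_iso H K \<longleftrightarrow>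
     (\<exists>f. bij_betw f (verts H) (verts K) \<and>
          (\<forall>u\<in>verts H. \<forall>v\<in>verts H. {u, v} \<in> edges H \<longleftrightarrow> {f u, f v} \<in> edges K))"

text \<open>Copies are counted as subgraphs (unlabelled), not as embeddings of \<open>H\<close>.\<close>

definition copies :: "'b ugraph \<Rightarrow> 'a ugraph \<Rightarrow> 'a ugraph set" where
  "copies H G = {K. subgraph K G \<and> graph_iso H K}"

definition is_free :: "'b ugraph \<Rightarrow> 'a ugraph \<Rightarrow> bool" where
  "is_free H G \<longleftrightarrow> copies H G = {}"

definition remove_edges :: "'a ugraph \<Rightarrow> 'a set set \<Rightarrow> 'a ugraph" where
  "remove_edges G F = (verts G, edges G - F)"

definition makes_free :: "'b ugraph \<Rightarrow> 'a ugraph \<Rightarrow> 'a set set \<Rightarrow> bool" where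
  "makes_free H G F \<longleftrightarrow> F \<subseteq> edges G \<and> is_free H (remove_edges G F)"

text \<open>
  At least \<open>x\<close> edges need to be removed from \<open>G\<close> to make it \<open>H\<close>-free: the least size of
  a set of edges whose removal makes \<open>G\<close> \<open>H\<close>-free is at least \<open>x\<close>.  The first conjunct says
  that this minimum exists.  It is automatic when \<open>H\<close> has an edge (remove all edges), and
  fails exactly when \<open>H\<close> is edgeless with at most as many vertices as \<open>G\<close>; in that case
  no removal of edges makes \<open>G\<close> \<open>H\<close>-free.
\<close>

definition needs_removal :: "'b ugraph \<Rightarrow> 'a ugraph \<Rightarrow> real \<Rightarrow> bool" where
  "needs_removal H G x \<longleftrightarrow>
     (\<exists>F. makes_free H G F) \<and> (\<forall>F. makes_free H G F \<longrightarrow> x \<le> real (card F))"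

text \<open>
  The tower of twos \<open>T\<close> with \<open>T(1) = 2\<close>, \<open>T(i + 1) = 2 ^ T(i)\<close> for \<open>i \<ge> 1\<close>, and
  \<open>T(i) = 1\<close> for \<open>i \<le> 0\<close>; negative heights are truncated to \<open>0\<close>.
\<close>

fun tower_nat :: "nat \<Rightarrow> nat" where
  "tower_nat 0 = 1"
| "tower_nat (Suc i) = 2 ^ tower_nat i"

definition tower :: "int \<Rightarrow> nat" where
  "tower i = tower_nat (nat i)"

end

theory Submission
  imports Defs "HOL-Library.FuncSet"
begin

text \<open>
  Take a maximal family of edge-disjoint copies of \<open>H\<close> in \<open>G\<close> and let \<open>R\<close> be the adjacency
  relation of its union: it has density \<open>d \<ge> 2 \<epsilon>\<close>, and a fraction \<open>1 / m\<close> of its edges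
  must be deleted to destroy all copies of \<open>H\<close>. For a vertex partition, consider the sum of
  \<open>d\<^sub>X\<^sub>Y ln d\<^sub>X\<^sub>Y\<close> over all pairs of parts, weighted by \<open>|X| |Y|\<close>; it lies between
  \<open>n\<^sup>2 d ln d\<close> and \<open>0\<close>. If few edges lie in shattered pairs (those of which a fraction
  \<open>1 / (2 m)\<close> is covered by boundedly many disjoint rectangles of much smaller density), some copy of
  \<open>H\<close> uses only large parts and dense unshattered pairs; a box spanned by such parts
  contains many copies of \<open>H\<close>, since otherwise it would be almost covered by sub-boxes that are
  sparse in one of the \<open>m\<close> edge directions, and a slice of these would shatter a pair.
  If many edges lie in shattered pairs, cutting along the rectangles raises the sum
  by at least a constant times \<open>n\<^sup>2 d / m\<^sup>2\<close> and costs one exponential in the number of parts, so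
  this happens only \<open>O(h\<^sup>4 log(1 / \<epsilon>))\<close> times. The entropy function, rather than the square, is
  what makes the number of steps logarithmic in \<open>1 / \<epsilon>\<close>.
\<close>

section \<open>Counting homomorphisms into a box\<close>

text \<open>Passing to the union of edge-disjoint copies puts loss and gain on one scale. With M
  copies it has \<open>2 * M * m\<close> ordered pairs, and at least M pairs must go to destroy all
  copies; in G itself \<open>\<epsilon> * n ^ 2\<close> edges may be a negligible fraction. The
  energy starts no lower than about \<open>- 2 * M * m * ln (1 / \<epsilon>)\<close> and a step
  gains \<open>3 * M / (32 * m)\<close>, so M cancels:
  \<open>16 * m ^ 2 * log 2 (1 / \<epsilon>)\<close> steps suffice, and
  \<open>2 * m \<le> h ^ 2\<close> turns \<open>16 * m ^ 2\<close> into \<open>4 * h ^ 4\<close>.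
  With squares of densities the range would be of order \<open>d * n ^ 2\<close> and the gain of
  order \<open>d ^ 2 * n ^ 2\<close>, hence about \<open>1 / d\<close> steps.

  No regularity in the usual two-sided sense is needed: a lower bound on homomorphisms only requires
  that no large rectangle is much too sparse.

  Partitions are recorded by generating sets. A step adds boundedly many generators for each pair of
  parts, so N generators become about \<open>4 ^ N\<close>, a single exponential.\<close>

definition homs :: "('i \<times> 'i) set \<Rightarrow> 'i set \<Rightarrow> ('i \<Rightarrow> 'a set) \<Rightarrow> ('a \<times> 'a) set \<Rightarrow> ('i \<Rightarrow> 'a) set" where
  "homs F I V R = {x \<in> PiE I V. \<forall>(i, j)\<in>F. (x i, x j) \<in> R}"

definition vol :: "'i set \<Rightarrow> ('i \<Rightarrow> 'a set) \<Rightarrow> real" where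
  "vol I V = (\<Prod>i\<in>I. real (card (V i)))"

lemma vol_nonneg: "0 \<le> vol I V"
  unfolding vol_def by (intro prod_nonneg) auto

lemma vol_split2:
  assumes "finite I" "i \<in> I" "j \<in> I" "i \<noteq> j"
  shows "vol I V = real (card (V i)) * real (card (V j)) * vol (I - {i, j}) V"
proof -
  have "vol I V = real (card (V i)) * vol (I - {i}) V"
    unfolding vol_def using assms by (intro prod.remove) auto
  also have "vol (I - {i}) V = real (card (V j)) * vol (I - {i} - {j}) V"
    unfolding vol_def using assms by (intro prod.remove) auto
  also have "I - {i} - {j} = I - {i, j}" by auto
  finally show ?thesis by simp
qed

lemma vol_PiE:
  assumes "finite I"
  shows "vol I V = real (card (PiE I V))"
  unfolding vol_def using assms by (simp add: card_PiE)

text \<open>Fix the coordinates \<open>z\<close> outside \<open>i\<close> and \<open>j\<close>. As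
  \<open>F\<close> joins \<open>i\<close> and \<open>j\<close> in neither direction, the admissible
  values at \<open>i\<close> and at \<open>j\<close> are independent and fill a rectangle; the edge
  \<open>(i, j)\<close> cuts this rectangle down to \<open>R\<close>.\<close>

lemma homs_fibres:
  assumes fin: "finite I" "\<And>i. i \<in> I \<Longrightarrow> finite (V i)"
    and ij: "i \<in> I" "j \<in> I" "i \<noteq> j"
    and F: "(i, j) \<notin> F" "(j, i) \<notin> F" "\<And>k l. (k, l) \<in> F \<Longrightarrow> k \<in> I \<and> l \<in> I \<and> k \<noteq> l"
  obtains A B where
    "\<And>z. A z \<subseteq> V i" "\<And>z. B z \<subseteq> V j"
    "real (card (homs F I V R)) = (\<Sum>z\<in>PiE (I - {i, j}) V. real (card (A z)) * real (card (B z)))"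
    "real (card (homs (insert (i, j) F) I V R))
      = (\<Sum>z\<in>PiE (I - {i, j}) V. real (card (R \<inter> A z \<times> B z)))"
proof
  define J where "J = I - {i, j}"
  define A where "A z = {u \<in> V i. \<forall>(k, l)\<in>F. k \<noteq> j \<longrightarrow> l \<noteq> j \<longrightarrow> ((z(i := u)) k, (z(i := u)) l) \<in> R}" for z
  define B where "B z = {v \<in> V j. \<forall>(k, l)\<in>F. k \<noteq> i \<longrightarrow> l \<noteq> i \<longrightarrow> ((z(j := v)) k, (z(j := v)) l) \<in> R}" for z
  define join where "join = (\<lambda>(z :: 'a \<Rightarrow> 'b, u, v). z(i := u, j := v))"
  show "A z \<subseteq> V i" "B z \<subseteq> V j" for z by (auto simp: A_def B_def)
  have finA: "finite (A z)" for z using fin(2)[OF ij(1)] by (auto simp: A_def)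
  have finB: "finite (B z)" for z using fin(2)[OF ij(2)] by (auto simp: B_def)
  have inj: "inj_on join (SIGMA z:PiE J V. C z)" for C
  proof (rule inj_onI, clarsimp simp: join_def)
    fix z u v z' u' v'
    assume z: "z \<in> PiE J V" "z' \<in> PiE J V" and eq: "z(i := u, j := v) = z'(i := u', j := v')"
    have "z k = z' k" for k
      using fun_cong[OF eq, of k] z by (cases "k = i \<or> k = j") (auto simp: J_def PiE_def extensional_def)
    moreover have "u = u'" "v = v'"
      using fun_cong[OF eq, of i] fun_cong[OF eq, of j] ij by auto
    ultimately show "z = z' \<and> u = u' \<and> v = v'" by auto
  qed
  have join_ij: "join p i = fst (snd p)" "join p j = snd (snd p)" for p
    using ij by (auto simp: join_def split: prod.splits)
  have main: "x \<in> homs F I V R \<longleftrightarrow> x \<in> join ` (SIGMA z:PiE J V. A z \<times> B z)" (is "_ \<longleftrightarrow> ?r") for x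
  proof
    assume x: "x \<in> homs F I V R"
    then have xP: "x \<in> PiE I V" and xR: "\<And>k l. (k, l) \<in> F \<Longrightarrow> (x k, x l) \<in> R"
      by (auto simp: homs_def)
    let ?z = "restrict x J"
    have ex: "x = join (?z, x i, x j)"
      using xP by (auto simp: join_def J_def fun_eq_iff PiE_def extensional_def)
    have "?z \<in> PiE J V" using xP by (auto simp: J_def)
    moreover have "x i \<in> A ?z"
      unfolding A_def using xP xR F(3) ij by (fastforce simp: J_def)
    moreover have "x j \<in> B ?z"
      unfolding B_def using xP xR F(3) ij by (fastforce simp: J_def)
    ultimately show ?r using ex by (intro image_eqI) auto
  next
    assume ?r
    then obtain z u v where x: "x = z(i := u, j := v)" and z: "z \<in> PiE J V" and u: "u \<in> A z" and v: "v \<in> B z"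
      by (auto simp: join_def)
    have "x \<in> PiE I V"
      using z u v ij unfolding x A_def B_def J_def by (auto simp: PiE_def extensional_def Pi_def)
    moreover have "(x k, x l) \<in> R" if kl: "(k, l) \<in> F" for k l
    proof (cases "k = j \<or> l = j")
      case False
      then have "((z(i := u)) k, (z(i := u)) l) \<in> R" using u kl by (auto simp: A_def)
      then show ?thesis using False x by simp
    next
      case True
      then have "k \<noteq> i" "l \<noteq> i" using F kl ij by auto
      then have "((z(j := v)) k, (z(j := v)) l) \<in> R" using v kl by (auto simp: B_def)
      then show ?thesis using \<open>k \<noteq> i\<close> \<open>l \<noteq> i\<close> x by (auto split: if_splits)
    qed
    ultimately show "x \<in> homs F I V R" by (auto simp: homs_def)
  qed
  have h1: "homs F I V R = join ` (SIGMA z:PiE J V. A z \<times> B z)" using main by blast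
  have h2: "homs (insert (i, j) F) I V R = join ` (SIGMA z:PiE J V. R \<inter> A z \<times> B z)"
  proof -
    have "homs (insert (i, j) F) I V R = {x \<in> homs F I V R. (x i, x j) \<in> R}"
      by (auto simp: homs_def)
    also have "\<dots> = join ` {p \<in> SIGMA z:PiE J V. A z \<times> B z. snd p \<in> R}"
      unfolding h1 by (auto simp: join_ij)
    also have "{p \<in> SIGMA z:PiE J V. A z \<times> B z. snd p \<in> R} = (SIGMA z:PiE J V. R \<inter> A z \<times> B z)"
      by auto
    finally show ?thesis .
  qed
  have finJ: "finite (PiE J V)" using fin by (intro finite_PiE) (auto simp: J_def)
  show "real (card (homs F I V R)) = (\<Sum>z\<in>PiE (I - {i, j}) V. real (card (A z)) * real (card (B z)))"
    unfolding h1 card_image[OF inj] J_def[symmetric]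
    using finJ finA finB by (subst card_SigmaI) (auto simp: card_cartesian_product)
  show "real (card (homs (insert (i, j) F) I V R)) = (\<Sum>z\<in>PiE (I - {i, j}) V. real (card (R \<inter> A z \<times> B z)))"
    unfolding h2 card_image[OF inj] J_def[symmetric]
    using finJ finA finB by (subst card_SigmaI) auto
qed

text \<open>Edges are inserted one at a time. Fibre rectangles occupying at least the fraction
  \<open>z\<close> of \<open>V i \<times> V j\<close> keep a factor \<open>2 * a\<close>. The
  smaller ones hold at most \<open>z * vol I V\<close>, which is at most half of the homomorphisms
  present before, because \<open>z \<le> a ^ Suc (card F) \<le> a ^ card F / 2\<close>. So an edge
  costs only a factor \<open>a\<close>.\<close>

lemma homs_lower_bound:
  fixes F :: "('i::linorder \<times> 'i) set" and R :: "('a \<times> 'a) set"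
  assumes fin: "finite I" "\<And>i. i \<in> I \<Longrightarrow> finite (V i)"
    and F: "finite F" "\<And>k l. (k, l) \<in> F \<Longrightarrow> k \<in> I \<and> l \<in> I \<and> k < l"
    and a: "0 < a" "a \<le> 1 / 2" and z: "0 \<le> z" "z \<le> a ^ card F"
    and dense: "\<And>i j A B. (i, j) \<in> F \<Longrightarrow> A \<subseteq> V i \<Longrightarrow> B \<subseteq> V j \<Longrightarrow>
       z * (real (card (V i)) * real (card (V j))) \<le> real (card A) * real (card B) \<Longrightarrow>
       2 * a * (real (card A) * real (card B)) \<le> real (card (R \<inter> A \<times> B))"
  shows "a ^ card F * vol I V \<le> real (card (homs F I V R))"
  using F z dense
proof (induction F rule: finite_induct)
  case empty
  have "homs {} I V R = PiE I V" by (auto simp: homs_def)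
  then show ?case using fin by (simp add: vol_PiE)
next
  case (insert e F)
  obtain i j where e: "e = (i, j)" by (cases e)
  have ij: "i \<in> I" "j \<in> I" "i < j" using insert.prems(1) e by auto
  have ji: "(j, i) \<notin> F" using insert.prems(1)[of j i] ij by auto
  have notin: "(i, j) \<notin> F" using insert.hyps e by simp
  have Fk: "k \<in> I \<and> l \<in> I \<and> k \<noteq> l" if "(k, l) \<in> F" for k l
    using insert.prems(1)[OF insertI2[OF that]] by auto
  have IH: "a ^ card F * vol I V \<le> real (card (homs F I V R))"
  proof (rule insert.IH)
    show "z \<le> a ^ card F"
      using insert.prems(3) insert.hyps a power_decreasing[of "card F" "Suc (card F)" a]
      by (simp add: order_trans)
    show "k \<in> I \<and> l \<in> I \<and> k < l" if "(k, l) \<in> F" for k l using insert.prems(1)[OF insertI2[OF that]] .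
    show "2 * a * (real (card A) * real (card B)) \<le> real (card (R \<inter> A \<times> B))"
      if "(i, j) \<in> F" "A \<subseteq> V i" "B \<subseteq> V j"
        "z * (real (card (V i)) * real (card (V j))) \<le> real (card A) * real (card B)" for i j A B
      by (rule insert.prems(4)[OF insertI2[OF that(1)] that(2-4)])
    show "0 \<le> z" by fact
  qed
  obtain A B where A: "\<And>z. A z \<subseteq> V i" and B: "\<And>z. B z \<subseteq> V j"
    and N: "real (card (homs F I V R)) = (\<Sum>z\<in>PiE (I - {i, j}) V. real (card (A z)) * real (card (B z)))"
    and N': "real (card (homs (insert (i, j) F) I V R))
      = (\<Sum>z\<in>PiE (I - {i, j}) V. real (card (R \<inter> A z \<times> B z)))"
    by (rule homs_fibres[OF fin ij(1,2) _ notin ji Fk, where R = R]) (use ij in auto)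
  \<comment> \<open>Subtracting the threshold in every fibre makes small fibres contribute at most
    0, so one sum handles both kinds.\<close>
  have "2 * a * (real (card (homs F I V R)) - z * vol I V)
      = (\<Sum>x\<in>PiE (I - {i, j}) V. 2 * a * (real (card (A x)) * real (card (B x)) - z * (real (card (V i)) * real (card (V j)))))"
    using ij fin(1) unfolding N
    by (subst vol_split2[of I i j])
       (auto simp: vol_PiE sum_subtractf sum_distrib_left sum.distrib algebra_simps)
  also have "\<dots> \<le> (\<Sum>x\<in>PiE (I - {i, j}) V. real (card (R \<inter> A x \<times> B x)))"
  proof (rule sum_mono)
    fix x
    show "2 * a * (real (card (A x)) * real (card (B x)) - z * (real (card (V i)) * real (card (V j))))
        \<le> real (card (R \<inter> A x \<times> B x))"
    proof (cases "z * (real (card (V i)) * real (card (V j))) \<le> real (card (A x)) * real (card (B x))")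
      case True
      then have "2 * a * (real (card (A x)) * real (card (B x))) \<le> real (card (R \<inter> A x \<times> B x))"
        using insert.prems(4)[of i j "A x" "B x"] A B e by auto
      moreover have "2 * a * (real (card (A x)) * real (card (B x)) - z * (real (card (V i)) * real (card (V j))))
         \<le> 2 * a * (real (card (A x)) * real (card (B x)))"
        using a insert.prems(2) by (intro mult_left_mono) auto
      ultimately show ?thesis by linarith
    next
      case False
      then have "2 * a * (real (card (A x)) * real (card (B x)) - z * (real (card (V i)) * real (card (V j)))) \<le> 0"
        using a by (intro mult_nonneg_nonpos) auto
      then show ?thesis by (meson of_nat_0_le_iff order_trans)
    qed
  qed
  finally have "2 * a * (real (card (homs F I V R)) - z * vol I V) \<le> real (card (homs (insert e F) I V R))"
    unfolding N' e .
  moreover have "a ^ Suc (card F) * vol I V \<le> 2 * a * (real (card (homs F I V R)) - z * vol I V)"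
  proof -
    have "z \<le> a ^ Suc (card F)" using insert.prems(3) insert.hyps by simp
    also have "\<dots> \<le> 1 / 2 * a ^ card F" using a by (simp add: mult_right_mono)
    finally have "z * vol I V \<le> 1 / 2 * a ^ card F * vol I V"
      using vol_nonneg by (intro mult_right_mono) auto
    then have "a ^ card F * vol I V \<le> 2 * (real (card (homs F I V R)) - z * vol I V)"
      using IH by (simp add: algebra_simps)
    then have "a * (a ^ card F * vol I V) \<le> a * (2 * (real (card (homs F I V R)) - z * vol I V))"
      using a by (intro mult_left_mono) auto
    then show ?thesis by (simp add: algebra_simps)
  qed
  ultimately show ?case using insert.hyps by simp
qed

section \<open>Sparse boxes and shattered pairs\<close>

lemma vol_upd:
  assumes "finite I" "i \<in> I"
  shows "vol I (V(i := A)) = real (card A) * vol (I - {i}) V"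
proof -
  have "vol I (V(i := A)) = real (card A) * vol (I - {i}) (V(i := A))"
    unfolding vol_def using assms by (subst prod.remove) auto
  then show ?thesis by (simp add: vol_def)
qed

lemma vol_remove:
  assumes "finite I" "i \<in> I"
  shows "vol I V = real (card (V i)) * vol (I - {i}) V"
  using vol_upd[OF assms, of V "V i"] by simp

lemma vol_cut:
  assumes "finite I" "i \<in> I" "finite (V i)" "A \<subseteq> V i"
  shows "vol I V = vol I (V(i := A)) + vol I (V(i := V i - A))"
proof -
  have "real (card (V i)) = real (card A) + real (card (V i - A))"
    using assms by (simp add: card_Diff_subset card_mono finite_subset of_nat_diff)
  then show ?thesis
    using assms by (simp add: vol_upd vol_remove[of I i V] algebra_simps)
qed

text \<open>\<open>P e A B\<close> will say that \<open>R\<close> is sparse on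
  \<open>A \<times> B\<close>; the label \<open>e\<close> keeps the sparse edge direction for a
  later pigeonhole. Sides are nonempty so that families living in disjoint boxes have no common
  member.\<close>

definition box_family ::
  "('i \<times> 'i) set \<Rightarrow> ('i \<times> 'i \<Rightarrow> 'a set \<Rightarrow> 'a set \<Rightarrow> bool) \<Rightarrow> 'i set \<Rightarrow> ('i \<Rightarrow> 'a set)
    \<Rightarrow> (('i \<times> 'i) \<times> ('i \<Rightarrow> 'a set)) set \<Rightarrow> bool" where
  "box_family F P I V BB \<longleftrightarrow> finite BB
    \<and> (\<forall>(e, W)\<in>BB. e \<in> F \<and> P e (W (fst e)) (W (snd e)) \<and> (\<forall>i\<in>I. W i \<subseteq> V i \<and> W i \<noteq> {}))
    \<and> (\<forall>p\<in>BB. \<forall>q\<in>BB. p \<noteq> q \<longrightarrow> (\<exists>i\<in>I. snd p i \<inter> snd q i = {}))"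

lemma box_family_join:
  assumes X: "box_family F P I V X" and Y: "box_family F P I V' Y"
    and sub: "\<And>k. k \<in> I \<Longrightarrow> V k \<subseteq> U k" "\<And>k. k \<in> I \<Longrightarrow> V' k \<subseteq> U k"
    and i: "i \<in> I" "V i \<inter> V' i = {}"
  shows "box_family F P I U (X \<union> Y)" and "X \<inter> Y = {}"
proof -
  have sep: "snd p i \<inter> snd q i = {}" if "p \<in> X" "q \<in> Y" for p q
  proof -
    have "snd p i \<subseteq> V i" "snd q i \<subseteq> V' i"
      using X Y that i(1) unfolding box_family_def by fastforce+
    then show ?thesis using i(2) by blast
  qed
  have ne: "snd p i \<noteq> {}" if "p \<in> X" for p
    using X that i(1) unfolding box_family_def by fastforce
  show "X \<inter> Y = {}" using sep ne by blast
  have *: "\<exists>i\<in>I. snd p i \<inter> snd q i = {}" if pq: "p \<in> X \<union> Y" "q \<in> X \<union> Y" "p \<noteq> q" for p q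
  proof -
    consider "p \<in> X" "q \<in> X" | "p \<in> Y" "q \<in> Y" | "p \<in> X" "q \<in> Y" | "q \<in> X" "p \<in> Y"
      using pq by blast
    then show ?thesis
    proof cases
      case 1 then show ?thesis using X pq(3) unfolding box_family_def by blast
    next
      case 2 then show ?thesis using Y pq(3) unfolding box_family_def by blast
    next
      case 3 then show ?thesis using sep i(1) by blast
    next
      case 4 then show ?thesis using sep[of q p] i(1) by blast
    qed
  qed
  show "box_family F P I U (X \<union> Y)"
    unfolding box_family_def
  proof (intro conjI)
    show "finite (X \<union> Y)" using X Y by (simp add: box_family_def)
    show "\<forall>(e, W)\<in>X \<union> Y. e \<in> F \<and> P e (W (fst e)) (W (snd e)) \<and> (\<forall>i\<in>I. W i \<subseteq> U i \<and> W i \<noteq> {})"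
      using X Y sub unfolding box_family_def by (simp add: Ball_def) (meson order_trans UnE)
    show "\<forall>p\<in>X \<union> Y. \<forall>q\<in>X \<union> Y. p \<noteq> q \<longrightarrow> (\<exists>i\<in>I. snd p i \<inter> snd q i = {})"
      using * by blast
  qed
qed

text \<open>A sparse pair \<open>A\<close>, \<open>B\<close> cuts a box into the box with sides
  \<open>A\<close>, \<open>B\<close>, which is kept, and two remainders, which are treated
  recursively. Each level leaves at most the fraction \<open>1 - z\<close> uncovered. Boxes of
  volume below \<open>b\<close> are given up, at most \<open>2 ^ s\<close> of them at depth
  \<open>s\<close>. The kept boxes are inner nodes of a binary tree of depth \<open>s\<close>, hence
  fewer than \<open>2 ^ s\<close>.\<close>

lemma box_cover:
  fixes V :: "'i \<Rightarrow> 'a set"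
  assumes fin: "finite I" "\<And>i. i \<in> I \<Longrightarrow> finite (V i)"
    and F: "\<And>k l. (k, l) \<in> F \<Longrightarrow> k \<in> I \<and> l \<in> I \<and> k \<noteq> l"
    and z: "0 < z" "z \<le> 1" and b: "0 < b"
    and step: "\<And>V'. (\<And>i. i \<in> I \<Longrightarrow> V' i \<subseteq> V i) \<Longrightarrow> b \<le> vol I V' \<Longrightarrow>
      \<exists>i j A B. (i, j) \<in> F \<and> A \<subseteq> V' i \<and> B \<subseteq> V' j \<and> P (i, j) A B
        \<and> z * (real (card (V' i)) * real (card (V' j))) \<le> real (card A) * real (card B)"
  shows "\<exists>BB. box_family F P I V BB \<and> card BB < 2 ^ s
     \<and> vol I V \<le> (\<Sum>(e, W)\<in>BB. vol I W) + (1 - z) ^ s * vol I V + 2 ^ s * b"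
  using fin(2) step
proof (induction s arbitrary: V)
  case 0
  have "box_family F P I V {}" by (simp add: box_family_def)
  then show ?case using b by (intro exI[of _ "{}"]) auto
next
  case (Suc s)
  show ?case
  proof (cases "b \<le> vol I V")
    case False
    have "b \<le> 2 ^ Suc s * b" using b by (simp add: mult_le_cancel_right1 del: power_Suc)
    moreover have "0 \<le> (1 - z) ^ Suc s * vol I V" using z vol_nonneg[of I V] by (intro mult_nonneg_nonneg) auto
    ultimately have "vol I V \<le> 0 + (1 - z) ^ Suc s * vol I V + 2 ^ Suc s * b" using False by linarith
    moreover have "box_family F P I V {}" by (simp add: box_family_def)
    ultimately show ?thesis by (intro exI[of _ "{}"]) auto
  next
    case True
    then obtain i j A B where ij: "(i, j) \<in> F" and A: "A \<subseteq> V i" and B: "B \<subseteq> V j" and P: "P (i, j) A B"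
      and AB: "z * (real (card (V i)) * real (card (V j))) \<le> real (card A) * real (card B)"
      using Suc.prems(2)[of V] by blast
    have I: "i \<in> I" "j \<in> I" "i \<noteq> j" using F[OF ij] by auto
    define W where "W = V(i := A, j := B)"
    define V1 where "V1 = V(i := V i - A)"
    define V2 where "V2 = V(i := A, j := V j - B)"
    have sub: "W k \<subseteq> V k" "V1 k \<subseteq> V k" "V2 k \<subseteq> V k" for k
      using A B by (auto simp: W_def V1_def V2_def)
    have volV: "vol I V = vol I W + vol I V1 + vol I V2"
      using vol_cut[of I i V A] vol_cut[of I j "V(i := A)" B] fin(1) Suc.prems(1) I A B
      by (simp add: W_def V1_def V2_def)
    have zW: "z * vol I V \<le> vol I W"
    proof -
      have "vol I W = real (card A) * real (card B) * vol (I - {i, j}) V"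
        using vol_split2[of I i j W] fin(1) I by (simp add: W_def vol_def)
      moreover have "vol I V = real (card (V i)) * real (card (V j)) * vol (I - {i, j}) V"
        using vol_split2[of I i j V] fin(1) I by simp
      ultimately show ?thesis
        using mult_right_mono[OF AB vol_nonneg[of "I - {i, j}" V]] by (simp add: mult_ac)
    qed
    have Wpos: "0 < vol I W"
      using zW True b z by (meson less_le_trans mult_pos_pos)
    have Wne: "W k \<noteq> {}" if "k \<in> I" for k
    proof
      assume "W k = {}"
      then have "vol I W = 0" unfolding vol_def using that fin(1) by (intro prod_zero bexI[of _ k]) auto
      then show False using Wpos by simp
    qed
    have ex: "\<exists>BB. box_family F P I V' BB \<and> card BB < 2 ^ s
       \<and> vol I V' \<le> (\<Sum>(e, W)\<in>BB. vol I W) + (1 - z) ^ s * vol I V' + 2 ^ s * b"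
      if "\<And>k. V' k \<subseteq> V k" for V'
    proof (rule Suc.IH)
      show "finite (V' i)" if "i \<in> I" for i
        using Suc.prems(1)[OF that] \<open>V' i \<subseteq> V i\<close> finite_subset by blast
    next
      fix V'' assume "\<And>i. i \<in> I \<Longrightarrow> V'' i \<subseteq> V' i" "b \<le> vol I V''"
      then show "\<exists>i j A B. (i, j) \<in> F \<and> A \<subseteq> V'' i \<and> B \<subseteq> V'' j \<and> P (i, j) A B
        \<and> z * (real (card (V'' i)) * real (card (V'' j))) \<le> real (card A) * real (card B)"
        using that by (intro Suc.prems(2)) (meson order_trans)+
    qed
    obtain B1 where B1: "box_family F P I V1 B1" "card B1 < 2 ^ s"
      "vol I V1 \<le> (\<Sum>(e, W)\<in>B1. vol I W) + (1 - z) ^ s * vol I V1 + 2 ^ s * b"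
      using ex[of V1] sub by blast
    obtain B2 where B2: "box_family F P I V2 B2" "card B2 < 2 ^ s"
      "vol I V2 \<le> (\<Sum>(e, W)\<in>B2. vol I W) + (1 - z) ^ s * vol I V2 + 2 ^ s * b"
      using ex[of V2] sub by blast
    have B0: "box_family F P I W {((i, j), W)}"
      using ij P I Wne by (auto simp: box_family_def W_def)
    \<comment> \<open>The box that splits into \<open>W\<close> and \<open>V2\<close>: these two are
      separated at \<open>j\<close>, and \<open>V3\<close> is separated from \<open>V1\<close> at
      \<open>i\<close>.\<close>
    define V3 where "V3 = V(i := A)"
    have join1: "box_family F P I V3 ({((i, j), W)} \<union> B2)" "{((i, j), W)} \<inter> B2 = {}"
      by (rule box_family_join[OF B0 B2(1), of V3 j]; use A B I in \<open>auto simp: W_def V2_def V3_def\<close>)+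
    have join2: "box_family F P I V (({((i, j), W)} \<union> B2) \<union> B1)" "({((i, j), W)} \<union> B2) \<inter> B1 = {}"
      by (rule box_family_join[OF join1(1) B1(1), of V i]; use A B I in \<open>auto simp: V1_def V3_def\<close>)+
    define BB where "BB = ({((i, j), W)} \<union> B2) \<union> B1"
    have finB: "finite B1" "finite B2" using B1(1) B2(1) by (auto simp: box_family_def)
    have sumBB: "(\<Sum>(e, W)\<in>BB. vol I W) = vol I W + (\<Sum>(e, W)\<in>B2. vol I W) + (\<Sum>(e, W)\<in>B1. vol I W)"
      unfolding BB_def using finB join1(2) join2(2) by (subst sum.union_disjoint) (auto simp: sum.union_disjoint)
    have "card BB \<le> 1 + card B2 + card B1"
      unfolding BB_def by (rule order_trans[OF card_Un_le]) (use finB in \<open>simp add: card_insert_if\<close>)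
    then have cBB: "card BB < 2 ^ Suc s" using B1(2) B2(2) by simp
    have "(1 - z) ^ s * (vol I V1 + vol I V2) \<le> (1 - z) ^ s * ((1 - z) * vol I V)"
      using zW volV z by (intro mult_left_mono) (auto simp: algebra_simps)
    then have "vol I V \<le> (\<Sum>(e, W)\<in>BB. vol I W) + (1 - z) ^ Suc s * vol I V + 2 ^ Suc s * b"
      using B1(3) B2(3) sumBB volV by (simp add: algebra_simps)
    then show ?thesis using join2(1) cBB unfolding BB_def by blast
  qed
qed

definition shattered :: "('a \<times> 'a) set \<Rightarrow> real \<Rightarrow> real \<Rightarrow> nat \<Rightarrow> 'a set \<Rightarrow> 'a set \<Rightarrow> bool" where
  "shattered R \<alpha> c t X Y \<longleftrightarrow> (\<exists>Q. finite Q \<and> card Q \<le> t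
     \<and> (\<forall>(A, B)\<in>Q. A \<subseteq> X \<and> B \<subseteq> Y \<and> real (card (R \<inter> A \<times> B)) \<le> \<alpha> * (real (card A) * real (card B)))
     \<and> (\<forall>p\<in>Q. \<forall>q\<in>Q. p \<noteq> q \<longrightarrow> (fst p \<times> snd p) \<inter> (fst q \<times> snd q) = {})
     \<and> c * (real (card X) * real (card Y)) \<le> (\<Sum>(A, B)\<in>Q. real (card A) * real (card B)))"

text \<open>Slice at a point \<open>z\<close> of the remaining coordinates. The total volume is the
  sum over \<open>z\<close> of the slice areas, so some \<open>z\<close> reaches the average. Two
  boxes that both contain \<open>z\<close> can only be disjoint at \<open>i\<close> or at
  \<open>j\<close>, so their slices are disjoint rectangles.\<close>

lemma box_family_slice:
  fixes V :: "'i \<Rightarrow> 'a set"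
  assumes fin: "finite I" "\<And>i. i \<in> I \<Longrightarrow> finite (V i)"
    and ij: "i \<in> I" "j \<in> I" "i \<noteq> j"
    and BB: "box_family F P I V BB" and lab: "\<And>e W. (e, W) \<in> BB \<Longrightarrow> e = (i, j)"
    and P: "\<And>A B. P (i, j) A B \<Longrightarrow> real (card (R \<inter> A \<times> B)) \<le> \<alpha> * (real (card A) * real (card B))"
    and vol: "c * vol I V \<le> (\<Sum>(e, W)\<in>BB. vol I W)" "0 < vol I V"
    and t: "card BB \<le> t"
  shows "shattered R \<alpha> c t (V i) (V j)"
proof -
  define J where "J = I - {i, j}"
  define S where "S z = {p \<in> BB. z \<in> PiE J (snd p)}" for z
  define f where "f = (\<lambda>p :: ('i \<times> 'i) \<times> ('i \<Rightarrow> 'a set). real (card (snd p i)) * real (card (snd p j)))"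
  have finBB: "finite BB" using BB by (simp add: box_family_def)
  have sub: "snd p k \<subseteq> V k" "snd p k \<noteq> {}" if "p \<in> BB" "k \<in> I" for p k
    using BB that unfolding box_family_def by fastforce+
  have finJ: "finite (PiE J V)" using fin by (intro finite_PiE) (auto simp: J_def)
  have "(\<Sum>(e, W)\<in>BB. vol I W) = (\<Sum>p\<in>BB. \<Sum>z\<in>PiE J V. if z \<in> PiE J (snd p) then f p else 0)"
  proof (rule sum.cong[OF refl], clarify)
    fix a b W assume W: "((a, b), W) \<in> BB"
    have "W k \<subseteq> V k" if "k \<in> J" for k
      using sub(1)[OF W, of k] that by (simp add: J_def)
    then have "PiE J W \<subseteq> PiE J V" by (rule PiE_mono)
    then have "PiE J V \<inter> PiE J W = PiE J W" by blast
    then have "(\<Sum>z\<in>PiE J V. if z \<in> PiE J W then f ((a, b), W) else 0) = f ((a, b), W) * real (card (PiE J W))"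
      using finJ by (simp add: sum.If_cases Int_def[symmetric])
    also have "\<dots> = vol I W"
      using vol_split2[of I i j W] fin(1) ij vol_PiE[of J W] by (simp add: f_def J_def)
    finally show "vol I W = (\<Sum>z\<in>PiE J V. if z \<in> PiE J (snd ((a, b), W)) then f ((a, b), W) else 0)"
      by simp
  qed
  also have "\<dots> = (\<Sum>z\<in>PiE J V. \<Sum>p\<in>BB. if z \<in> PiE J (snd p) then f p else 0)"
    by (rule sum.swap)
  also have "\<dots> = (\<Sum>z\<in>PiE J V. \<Sum>p\<in>S z. f p)"
    unfolding S_def by (rule sum.cong[OF refl]) (simp add: sum.inter_filter finBB)
  finally have sumS: "(\<Sum>(e, W)\<in>BB. vol I W) = (\<Sum>z\<in>PiE J V. \<Sum>p\<in>S z. f p)" .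
  have "\<exists>z\<in>PiE J V. c * (real (card (V i)) * real (card (V j))) \<le> (\<Sum>p\<in>S z. f p)"
  proof (rule ccontr)
    assume "\<not> ?thesis"
    then have less: "(\<Sum>p\<in>S z. f p) < c * (real (card (V i)) * real (card (V j)))" if "z \<in> PiE J V" for z
      using that by force
    have volI: "vol I V = real (card (V i)) * real (card (V j)) * real (card (PiE J V))"
      using vol_split2[of I i j V] fin(1) ij vol_PiE[of J V] by (simp add: J_def)
    then have ne: "PiE J V \<noteq> {}" using vol(2) by force
    have "(\<Sum>z\<in>PiE J V. \<Sum>p\<in>S z. f p) < (\<Sum>z\<in>PiE J V. c * (real (card (V i)) * real (card (V j))))"
      using less finJ ne by (intro sum_strict_mono) auto
    then show False using sumS volI vol(1) by (simp add: mult_ac)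
  qed
  then obtain z where z: "z \<in> PiE J V" and big: "c * (real (card (V i)) * real (card (V j))) \<le> (\<Sum>p\<in>S z. f p)"
    by blast
  define g where "g = (\<lambda>p :: ('i \<times> 'i) \<times> ('i \<Rightarrow> 'a set). (snd p i, snd p j))"
  have disj: "(snd p i \<times> snd p j) \<inter> (snd q i \<times> snd q j) = {}" if pq: "p \<in> S z" "q \<in> S z" "p \<noteq> q" for p q
  proof -
    obtain k where k: "k \<in> I" "snd p k \<inter> snd q k = {}"
      using BB pq unfolding box_family_def S_def by blast
    have "k \<notin> J" using k pq unfolding S_def by (auto simp: PiE_def Pi_def)
    then show ?thesis using k by (auto simp: J_def)
  qed
  have inj: "inj_on g (S z)"
  proof (rule inj_onI, rule ccontr)
    fix p q assume "p \<in> S z" "q \<in> S z" "g p = g q" "p \<noteq> q"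
    then show False using disj[of p q] sub(2)[of p i] sub(2)[of p j] ij by (auto simp: g_def S_def)
  qed
  have finS: "finite (S z)" using finBB by (simp add: S_def)
  show ?thesis
    unfolding shattered_def
  proof (intro exI[of _ "g ` S z"] conjI)
    show "finite (g ` S z)" using finS by simp
    have "card (S z) \<le> card BB" using finBB by (intro card_mono) (auto simp: S_def)
    then show "card (g ` S z) \<le> t" using card_image_le[OF finS, of g] t by linarith
    show "\<forall>(A, B)\<in>g ` S z. A \<subseteq> V i \<and> B \<subseteq> V j \<and> real (card (R \<inter> A \<times> B)) \<le> \<alpha> * (real (card A) * real (card B))"
    proof (clarsimp simp: g_def)
      fix a b W assume "((a, b), W) \<in> S z"
      then have W: "((a, b), W) \<in> BB" by (simp add: S_def)
      then have "P (i, j) (W i) (W j)"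
        using BB lab[OF W] unfolding box_family_def by fastforce
      then show "W i \<subseteq> V i \<and> W j \<subseteq> V j \<and> real (card (R \<inter> W i \<times> W j)) \<le> \<alpha> * (real (card (W i)) * real (card (W j)))"
        using P sub(1)[OF W] ij by auto
    qed
    show "\<forall>p\<in>g ` S z. \<forall>q\<in>g ` S z. p \<noteq> q \<longrightarrow> (fst p \<times> snd p) \<inter> (fst q \<times> snd q) = {}"
      using disj unfolding g_def by fastforce
    have "(\<Sum>(A, B)\<in>g ` S z. real (card A) * real (card B)) = (\<Sum>p\<in>S z. f p)"
      unfolding sum.reindex[OF inj] by (simp add: g_def f_def)
    then show "c * (real (card (V i)) * real (card (V j))) \<le> (\<Sum>(A, B)\<in>g ` S z. real (card A) * real (card B))"
      using big by simp
  qed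
qed

lemma homs_mono:
  assumes "\<And>i. i \<in> I \<Longrightarrow> W i \<subseteq> V i"
  shows "homs F I W R \<subseteq> homs F I V R"
  using assms by (auto simp: homs_def PiE_def Pi_def)

text \<open>A sub-box of volume at least \<open>b\<close> without large sparse pairs would contain
  \<open>z * b\<close> homomorphisms by \<open>homs_lower_bound\<close>, against \<open>few\<close>.
  So \<open>box_cover\<close> applies and covers half of the box; one of the \<open>card F\<close>
  directions covers the fraction \<open>1 / (2 * card F)\<close>, and a slice of its boxes shatters
  a pair.\<close>

lemma shattered_or_many_homs:
  fixes F :: "('i::linorder \<times> 'i) set" and V :: "'i \<Rightarrow> 'a set" and q :: nat
  assumes fin: "finite I" "\<And>i. i \<in> I \<Longrightarrow> finite (V i)" and ne: "\<And>i. i \<in> I \<Longrightarrow> V i \<noteq> {}"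
    and F: "finite F" "F \<noteq> {}" "\<And>k l. (k, l) \<in> F \<Longrightarrow> k \<in> I \<and> l \<in> I \<and> k < l"
    and q: "2 \<le> q"
    and few: "4 * q ^ card F * 2 ^ (2 * q ^ card F) * real (card (homs F I V R)) < vol I V"
  shows "\<exists>(i, j)\<in>F. shattered R (2 / q) (1 / (2 * card F)) (2 ^ (2 * q ^ card F)) (V i) (V j)"
proof -
  define m where "m = card F"
  define a where "a = 1 / real q"
  define z where "z = a ^ m"
  \<comment> \<open>As \<open>z = 1 / q ^ m\<close>, this depth leaves at most
    \<open>exp (- 2) \<le> 1 / 4\<close> uncovered; the choice of \<open>b\<close> limits the
    abandoned boxes to another quarter.\<close>
  define s where "s = 2 * q ^ m"
  define b where "b = vol I V / (4 * 2 ^ s)"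
  define P where "P = (\<lambda>(e :: 'i \<times> 'i) A B. real (card (R \<inter> A \<times> B)) \<le> 2 * a * (real (card A) * real (card B)))"
  have m: "m > 0" using F unfolding m_def by (simp add: card_gt_0_iff)
  have volpos: "0 < vol I V" unfolding vol_def using fin ne by (intro prod_pos) (auto simp: card_gt_0_iff)
  have a: "0 < a" "a \<le> 1 / 2" using q by (auto simp: a_def field_simps)
  have z: "0 < z" "z \<le> 1" using a by (auto simp: z_def power_le_one)
  have b: "0 < b" using volpos by (simp add: b_def)
  have finW: "finite (W i)" if "\<And>i. i \<in> I \<Longrightarrow> W i \<subseteq> V i" "i \<in> I" for W i
    using that fin(2) finite_subset by blast
  have step: "\<exists>i j A B. (i, j) \<in> F \<and> A \<subseteq> W i \<and> B \<subseteq> W j \<and> P (i, j) A B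
        \<and> z * (real (card (W i)) * real (card (W j))) \<le> real (card A) * real (card B)"
    if W: "\<And>i. i \<in> I \<Longrightarrow> W i \<subseteq> V i" and vW: "b \<le> vol I W" for W
  proof (rule ccontr)
    assume neg: "\<not> ?thesis"
    have "a ^ card F * vol I W \<le> real (card (homs F I W R))"
    proof (rule homs_lower_bound[where z = z])
      fix i j A B assume "(i, j) \<in> F" "A \<subseteq> W i" "B \<subseteq> W j"
        "z * (real (card (W i)) * real (card (W j))) \<le> real (card A) * real (card B)"
      then have "\<not> P (i, j) A B" using neg by blast
      then show "2 * a * (real (card A) * real (card B)) \<le> real (card (R \<inter> A \<times> B))"
        by (simp add: P_def)
    qed (use fin finW W F a z in \<open>auto simp: z_def m_def\<close>)
    also have "\<dots> \<le> real (card (homs F I V R))"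
    proof -
      have "finite (homs F I V R)"
        by (rule finite_subset[of _ "PiE I V"]) (use fin in \<open>auto simp: homs_def intro: finite_PiE\<close>)
      then show ?thesis using homs_mono[of I W V F R] W by (simp add: card_mono)
    qed
    finally have "z * b \<le> real (card (homs F I V R))"
      using vW z unfolding m_def[symmetric] z_def[symmetric] by (meson less_imp_le mult_left_mono order_trans)
    moreover have "4 * q ^ m * 2 ^ s * (z * b) = vol I V"
      using q by (simp add: z_def b_def a_def power_one_over)
    ultimately have "vol I V \<le> 4 * q ^ m * 2 ^ s * real (card (homs F I V R))"
      by (metis mult_left_mono of_nat_0_le_iff of_nat_mult of_nat_numeral of_nat_power)
    then show False using few by (simp add: m_def s_def)
  qed
  obtain BB where BB: "box_family F P I V BB" "card BB < 2 ^ s"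
    and cov: "vol I V \<le> (\<Sum>(e, W)\<in>BB. vol I W) + (1 - z) ^ s * vol I V + 2 ^ s * b"
    using box_cover[of I V F z b P s] fin F(3) z b step by blast
  have finBB: "finite BB" using BB by (simp add: box_family_def)
  have "(1 - z) ^ s \<le> 1 / 4"
  proof -
    have "(1 - z) ^ s \<le> exp (- z) ^ s"
      using exp_ge_add_one_self[of "- z"] z by (intro power_mono) auto
    also have "\<dots> = exp (- (2 * (z * q ^ m)))" by (simp add: s_def exp_of_nat_mult[symmetric] mult_ac)
    also have "z * q ^ m = 1" using q by (simp add: z_def a_def power_one_over)
    also have "exp (- (2 * 1)) \<le> (1 / 4 :: real)"
    proof -
      have "(2 :: real) \<le> exp 1" using exp_ge_add_one_self[of 1] by simp
      then have "2 * 2 \<le> exp 1 * exp (1 :: real)" by (intro mult_mono) auto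
      then have "4 \<le> exp (2 :: real)" by (simp add: exp_add[symmetric])
      then show ?thesis by (simp add: exp_minus field_simps)
    qed
    finally show ?thesis .
  qed
  then have "(1 - z) ^ s * vol I V \<le> 1 / 4 * vol I V" using vol_nonneg by (intro mult_right_mono) auto
  moreover have "2 ^ s * b = 1 / 4 * vol I V" by (simp add: b_def)
  ultimately have half: "vol I V / 2 \<le> (\<Sum>(e, W)\<in>BB. vol I W)" using cov by simp
  have "\<exists>e\<in>F. 1 / (2 * m) * vol I V \<le> (\<Sum>(e', W)\<in>{p \<in> BB. fst p = e}. vol I W)"
  proof (rule ccontr)
    assume "\<not> ?thesis"
    then have less: "(\<Sum>(e', W)\<in>{p \<in> BB. fst p = e}. vol I W) < 1 / (2 * m) * vol I V" if "e \<in> F" for e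
      using that by force
    have "(\<Sum>(e, W)\<in>BB. vol I W) = (\<Sum>e\<in>F. \<Sum>(e', W)\<in>{p \<in> BB. fst p = e}. vol I W)"
      using BB(1) finBB F(1) unfolding box_family_def by (subst sum.group) auto
    also have "\<dots> < (\<Sum>e\<in>F. 1 / (2 * m) * vol I V)"
      using less F by (intro sum_strict_mono) auto
    also have "\<dots> = vol I V / 2" using m by (simp add: m_def[symmetric])
    finally show False using half by simp
  qed
  then obtain i j where ij: "(i, j) \<in> F"
    and big: "1 / (2 * m) * vol I V \<le> (\<Sum>(e', W)\<in>{p \<in> BB. fst p = (i, j)}. vol I W)" by auto
  have "shattered R (2 * a) (1 / (2 * m)) (2 ^ s) (V i) (V j)"
  proof (rule box_family_slice[where BB = "{p \<in> BB. fst p = (i, j)}"])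
    show "box_family F P I V {p \<in> BB. fst p = (i, j)}"
      using BB(1) finBB unfolding box_family_def by auto
    have "card {p \<in> BB. fst p = (i, j)} \<le> card BB" using finBB by (intro card_mono) auto
    then show "card {p \<in> BB. fst p = (i, j)} \<le> 2 ^ s" using BB(2) by linarith
  qed (use fin F(3)[OF ij] big volpos in \<open>auto simp: P_def\<close>)
  then show ?thesis using ij by (auto simp: a_def m_def s_def)
qed

section \<open>Entropy of a partition\<close>

text \<open>The cell of \<open>x\<close> in the partition of \<open>U\<close> generated by
  \<open>SS\<close>. Refining means enlarging \<open>SS\<close>.\<close>

definition atom :: "'a set \<Rightarrow> 'a set set \<Rightarrow> 'a \<Rightarrow> 'a set" where
  "atom U SS x = {y \<in> U. \<forall>S\<in>SS. y \<in> S \<longleftrightarrow> x \<in> S}"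

lemma atom_self: "x \<in> U \<Longrightarrow> x \<in> atom U SS x"
  by (simp add: atom_def)

lemma atom_sub: "atom U SS x \<subseteq> U"
  by (auto simp: atom_def)

lemma atom_eq: "y \<in> atom U SS x \<Longrightarrow> atom U SS y = atom U SS x"
  by (auto simp: atom_def)

lemma atom_sym: "x \<in> U \<Longrightarrow> y \<in> atom U SS x \<Longrightarrow> x \<in> atom U SS y"
  by (auto simp: atom_def)

lemma atom_refine: "SS \<subseteq> SS' \<Longrightarrow> atom U SS' x \<subseteq> atom U SS x"
  by (auto simp: atom_def)

lemma card_atom_pos: "finite U \<Longrightarrow> x \<in> U \<Longrightarrow> 0 < card (atom U SS x)"
  using atom_self[of x U SS] finite_subset[OF atom_sub, of U SS x] by (auto simp: card_gt_0_iff)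

lemma card_atoms:
  assumes "finite SS"
  shows "finite (atom U SS ` U)" "card (atom U SS ` U) \<le> 2 ^ card SS"
proof -
  have sub: "atom U SS ` U \<subseteq> (\<lambda>T. {y \<in> U. \<forall>S\<in>SS. y \<in> S \<longleftrightarrow> S \<in> T}) ` Pow SS"
  proof
    fix X assume "X \<in> atom U SS ` U"
    then obtain x where "X = atom U SS x" by blast
    then have "X = {y \<in> U. \<forall>S\<in>SS. y \<in> S \<longleftrightarrow> S \<in> {S \<in> SS. x \<in> S}}" by (auto simp: atom_def)
    then show "X \<in> (\<lambda>T. {y \<in> U. \<forall>S\<in>SS. y \<in> S \<longleftrightarrow> S \<in> T}) ` Pow SS" by blast
  qed
  show "finite (atom U SS ` U)" by (rule finite_subset[OF sub]) (simp add: assms)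
  have "card (atom U SS ` U) \<le> card (Pow SS)"
    using surj_card_le[OF _ sub] assms by simp
  then show "card (atom U SS ` U) \<le> 2 ^ card SS" using assms by (simp add: card_Pow)
qed

text \<open>A function of points rather than of cells, so that sums over \<open>U \<times> U\<close>
  carry the weights of the cells.\<close>

definition dens :: "('a \<times> 'a) set \<Rightarrow> 'a set \<Rightarrow> 'a set set \<Rightarrow> 'a \<times> 'a \<Rightarrow> real" where
  "dens R U SS p = real (card (R \<inter> atom U SS (fst p) \<times> atom U SS (snd p)))
     / (real (card (atom U SS (fst p))) * real (card (atom U SS (snd p))))"

lemma dens_nonneg: "0 \<le> dens R U SS p"
  by (simp add: dens_def)

lemma dens_le_1:
  assumes "finite U"
  shows "dens R U SS p \<le> 1"
proof -
  have fin: "finite (atom U SS x)" for x by (rule finite_subset[OF atom_sub assms])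
  have "card (R \<inter> atom U SS (fst p) \<times> atom U SS (snd p)) \<le> card (atom U SS (fst p) \<times> atom U SS (snd p))"
    using fin by (intro card_mono) auto
  then have "real (card (R \<inter> atom U SS (fst p) \<times> atom U SS (snd p)))
     \<le> real (card (atom U SS (fst p))) * real (card (atom U SS (snd p)))"
    unfolding card_cartesian_product of_nat_mult[symmetric] of_nat_le_iff .
  then show ?thesis unfolding dens_def by (auto simp: divide_le_eq_1 zero_less_mult_iff)
qed

lemma dens_cong:
  assumes "fst q \<in> atom U SS (fst p)" "snd q \<in> atom U SS (snd p)"
  shows "dens R U SS q = dens R U SS p"
  using atom_eq[OF assms(1)] atom_eq[OF assms(2)] by (simp add: dens_def)

definition measurable_on :: "'a set \<Rightarrow> 'a set set \<Rightarrow> ('a \<times> 'a \<Rightarrow> 'b) \<Rightarrow> bool" where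
  "measurable_on U SS g \<longleftrightarrow> (\<forall>p\<in>U \<times> U. \<forall>q\<in>U \<times> U.
     fst q \<in> atom U SS (fst p) \<longrightarrow> snd q \<in> atom U SS (snd p) \<longrightarrow> g q = g p)"

lemma measurable_onD:
  "measurable_on U SS g \<Longrightarrow> x' \<in> atom U SS x \<Longrightarrow> y' \<in> atom U SS y \<Longrightarrow> x \<in> U \<Longrightarrow> y \<in> U \<Longrightarrow> g (x', y') = g (x, y)"
  unfolding measurable_on_def using atom_sub by fastforce

lemma measurable_on_refine:
  assumes "measurable_on U SS g" "SS \<subseteq> SS'"
  shows "measurable_on U SS' g"
  using assms atom_refine[OF assms(2)] unfolding measurable_on_def by blast

lemma measurable_on_dens: "measurable_on U SS (dens R U SS)"
  unfolding measurable_on_def by (auto intro: dens_cong)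

text \<open>The density function is the conditional expectation of the indicator of \<open>R\<close>.\<close>

lemma sum_dens_mult:
  fixes g :: "'a \<times> 'a \<Rightarrow> real"
  assumes U: "finite U" and g: "measurable_on U SS g"
  shows "(\<Sum>p\<in>U \<times> U. dens R U SS p * g p) = (\<Sum>p\<in>R \<inter> U \<times> U. g p)"
proof -
  let ?at = "atom U SS"
  define w where "w p = real (card (?at (fst p))) * real (card (?at (snd p)))" for p
  define N where "N p = ?at (fst p) \<times> ?at (snd p)" for p
  have fin: "finite (U \<times> U)" using U by simp
  have NU: "N p \<subseteq> U \<times> U" for p using atom_sub[of U SS] by (auto simp: N_def)
  have sym: "q \<in> N p \<longleftrightarrow> p \<in> N q" if "p \<in> U \<times> U" "q \<in> U \<times> U" for p q
    using that by (auto simp: N_def intro: atom_sym)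
  have wN: "w q = w p" if "q \<in> N p" for p q
    using that atom_eq[of _ U SS] by (auto simp: w_def N_def)
  have gN: "g q = g p" if "q \<in> N p" "p \<in> U \<times> U" for p q
    using that measurable_onD[OF g] by (auto simp: N_def)
  have wpos: "0 < w p" if "p \<in> U \<times> U" for p
    using that card_atom_pos[OF U] by (auto simp: w_def)
  have cN: "real (card (N p)) = w p" for p by (simp add: N_def w_def card_cartesian_product)
  \<comment> \<open>Each pair \<open>q\<close> of \<open>R\<close> spreads the mass
    \<open>g q\<close> evenly over the \<open>w q\<close> pairs of its rectangle of cells, on which
    \<open>g\<close> is constant.\<close>
  have "(\<Sum>p\<in>U \<times> U. dens R U SS p * g p) = (\<Sum>p\<in>U \<times> U. \<Sum>q\<in>R \<inter> U \<times> U. if q \<in> N p then g p / w p else 0)"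
  proof (rule sum.cong[OF refl])
    fix p assume p: "p \<in> U \<times> U"
    have "(\<Sum>q\<in>R \<inter> U \<times> U. if q \<in> N p then g p / w p else 0) = real (card (R \<inter> U \<times> U \<inter> N p)) * (g p / w p)"
      using fin by (simp add: sum.If_cases Int_def[symmetric] Collect_mem_eq)
    also have "R \<inter> U \<times> U \<inter> N p = R \<inter> N p" using NU by blast
    finally show "dens R U SS p * g p = (\<Sum>q\<in>R \<inter> U \<times> U. if q \<in> N p then g p / w p else 0)"
      by (simp add: dens_def w_def N_def)
  qed
  also have "\<dots> = (\<Sum>q\<in>R \<inter> U \<times> U. \<Sum>p\<in>U \<times> U. if q \<in> N p then g p / w p else 0)"
    by (rule sum.swap)
  also have "\<dots> = (\<Sum>q\<in>R \<inter> U \<times> U. g q)"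
  proof (rule sum.cong[OF refl])
    fix q assume q: "q \<in> R \<inter> U \<times> U"
    have "(\<Sum>p\<in>U \<times> U. if q \<in> N p then g p / w p else 0) = (\<Sum>p\<in>U \<times> U. if p \<in> N q then g q / w q else 0)"
    proof (rule sum.cong[OF refl])
      fix p assume p: "p \<in> U \<times> U"
      show "(if q \<in> N p then g p / w p else 0) = (if p \<in> N q then g q / w q else 0)"
        using sym[OF p, of q] gN[of q p] wN[of q p] p q by auto
    qed
    also have "\<dots> = real (card (U \<times> U \<inter> N q)) * (g q / w q)"
      using fin by (simp add: sum.If_cases Int_def[symmetric] Collect_mem_eq)
    also have "U \<times> U \<inter> N q = N q" using NU by blast
    also have "real (card (N q)) * (g q / w q) = g q" using wpos[of q] q by (simp add: cN)
    finally show "(\<Sum>p\<in>U \<times> U. if q \<in> N p then g p / w p else 0) = g q" .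
  qed
  finally show ?thesis .
qed

definition energy :: "('a \<times> 'a) set \<Rightarrow> 'a set \<Rightarrow> 'a set set \<Rightarrow> real" where
  "energy R U SS = (\<Sum>p\<in>U \<times> U. dens R U SS p * ln (dens R U SS p))"

lemma energy_nonpos:
  assumes "finite U"
  shows "energy R U SS \<le> 0"
  unfolding energy_def
proof (rule sum_nonpos)
  fix p
  have "ln (dens R U SS p) \<le> 0" if "dens R U SS p \<noteq> 0"
    using that dens_nonneg[of R U SS p] dens_le_1[OF assms, of R SS p] by simp
  then show "dens R U SS p * ln (dens R U SS p) \<le> 0"
    using dens_nonneg[of R U SS p] by (cases "dens R U SS p = 0") (auto intro: mult_nonneg_nonpos)
qed

text \<open>Convexity of \<open>x * ln x\<close>: the left side is its tangent at \<open>y\<close>,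
  evaluated at \<open>x\<close>.\<close>

lemma xlnx_tangent:
  fixes x y :: real
  assumes "0 \<le> x" "0 < y"
  shows "x * ln y + x - y \<le> x * ln x"
proof (cases "x = 0")
  case False
  then have x: "0 < x" using assms by simp
  have "ln (y / x) \<le> y / x - 1" using x assms by (intro ln_le_minus_one) simp
  then have "x * ln (y / x) \<le> x * (y / x - 1)" using x by (intro mult_left_mono) auto
  then show ?thesis using x assms by (simp add: ln_div algebra_simps)
qed (use assms in auto)

text \<open>Pointwise tangent inequality at the old density \<open>D\<close>, but at
  \<open>D / 2\<close> on \<open>T\<close>. In the sum, the terms \<open>D' * ln D\<close> give back
  the old energy, because \<open>ln D\<close> is constant on old cells, and the terms
  \<open>D' - D\<close> cancel. The shifted tangent leaves \<open>D / 2 - ln 2 * D'\<close> on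
  \<open>T\<close>, a gain if \<open>R\<close> is sparse there; \<open>D'\<close> sums to
  \<open>card (R \<inter> T)\<close> since \<open>T\<close> is a union of rectangles of new
  cells.\<close>

lemma energy_increment:
  assumes U: "finite U" and sub: "SS \<subseteq> SS'" and T: "T \<subseteq> U \<times> U" "measurable_on U SS' (\<lambda>p. p \<in> T)"
  shows "energy R U SS + (\<Sum>p\<in>T. dens R U SS p) / 2 - ln 2 * real (card (R \<inter> T)) \<le> energy R U SS'"
proof -
  define D where "D = dens R U SS"
  define D' where "D' = dens R U SS'"
  have fin: "finite (U \<times> U)" using U by simp
  have mD: "measurable_on U SS (\<lambda>p. ln (D p))"
    using measurable_on_dens[of U SS R] unfolding measurable_on_def D_def by metis
  \<comment> \<open>There is no tangent at 0, but where the old density vanishes so does the new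
    one.\<close>
  have D0: "D' p = 0" if "D p = 0" "p \<in> U \<times> U" for p
  proof -
    have fa: "finite (R \<inter> atom U SS (fst p) \<times> atom U SS (snd p))"
      using U atom_sub[of U SS] by (meson finite_Int finite_SigmaI finite_subset)
    have "R \<inter> atom U SS (fst p) \<times> atom U SS (snd p) = {}"
      using that card_atom_pos[OF U, of "fst p" SS] card_atom_pos[OF U, of "snd p" SS] fa
      by (auto simp: D_def dens_def)
    then have "R \<inter> atom U SS' (fst p) \<times> atom U SS' (snd p) = {}"
      using atom_refine[OF sub] by blast
    then show ?thesis by (simp add: D'_def dens_def)
  qed
  define c where "c = (\<lambda>p. if p \<in> T then 1 else 0 :: real)"
  have mc: "measurable_on U SS' c" using T(2) unfolding measurable_on_def c_def by auto
  have m1: "measurable_on U S (\<lambda>p. 1 :: real)" for S by (simp add: measurable_on_def)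
  have pt: "D' p * ln (D p) + D' p - D p + (c p * D p / 2 - ln 2 * (D' p * c p)) \<le> D' p * ln (D' p)"
    if p: "p \<in> U \<times> U" for p
  proof (cases "D p = 0")
    case True then show ?thesis using D0[OF True p] by simp
  next
    case False
    then have Dp: "0 < D p" using dens_nonneg[of R U SS p] by (simp add: D_def)
    have D'p: "0 \<le> D' p" using dens_nonneg by (simp add: D'_def)
    show ?thesis
    proof (cases "p \<in> T")
      case True
      have "D' p * ln (D p / 2) + D' p - D p / 2 \<le> D' p * ln (D' p)"
        using xlnx_tangent[OF D'p, of "D p / 2"] Dp by simp
      then show ?thesis using True Dp by (simp add: c_def ln_div algebra_simps)
    next
      case False
      then show ?thesis using xlnx_tangent[OF D'p Dp] by (simp add: c_def)
    qed
  qed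
  have s1: "(\<Sum>p\<in>U \<times> U. D' p * ln (D p)) = energy R U SS"
    using sum_dens_mult[OF U measurable_on_refine[OF mD sub], of R] sum_dens_mult[OF U mD, of R]
    by (simp add: energy_def D_def D'_def)
  have s2: "(\<Sum>p\<in>U \<times> U. D' p) = (\<Sum>p\<in>U \<times> U. D p)"
    using sum_dens_mult[OF U m1, of R SS] sum_dens_mult[OF U m1, of R SS'] by (simp add: D_def D'_def)
  have s3: "(\<Sum>p\<in>U \<times> U. D' p * c p) = real (card (R \<inter> T))"
  proof -
    have "(\<Sum>p\<in>U \<times> U. D' p * c p) = (\<Sum>p\<in>R \<inter> U \<times> U. c p)"
      using sum_dens_mult[OF U mc, of R] by (simp add: D'_def)
    also have "\<dots> = real (card (R \<inter> U \<times> U \<inter> T))"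
      using fin by (simp add: c_def sum.If_cases Collect_mem_eq)
    also have "R \<inter> U \<times> U \<inter> T = R \<inter> T" using T by blast
    finally show ?thesis .
  qed
  have s4: "(\<Sum>p\<in>U \<times> U. c p * D p / 2) = (\<Sum>p\<in>T. D p) / 2"
  proof -
    have "(\<Sum>p\<in>U \<times> U. c p * D p) = (\<Sum>p\<in>U \<times> U. if p \<in> T then D p else 0)"
      by (intro sum.cong) (auto simp: c_def)
    also have "\<dots> = (\<Sum>p\<in>U \<times> U \<inter> T. D p)" using fin by (simp add: sum.If_cases Collect_mem_eq)
    also have "U \<times> U \<inter> T = T" using T by blast
    finally show ?thesis by (simp add: sum_divide_distrib[symmetric])
  qed
  have "(\<Sum>p\<in>U \<times> U. D' p * ln (D p) + D' p - D p + (c p * D p / 2 - ln 2 * (D' p * c p)))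
     \<le> (\<Sum>p\<in>U \<times> U. D' p * ln (D' p))"
    using pt by (rule sum_mono)
  then show ?thesis
    using s1 s2 s3 s4 by (simp add: sum.distrib sum_subtractf sum_distrib_left[symmetric] energy_def D_def D'_def)
qed

lemma atoms_disjoint:
  assumes "X \<in> atom U SS ` U" "Y \<in> atom U SS ` U" "X \<noteq> Y"
  shows "X \<inter> Y = {}"
proof (rule ccontr)
  assume "X \<inter> Y \<noteq> {}"
  then obtain z where "z \<in> X" "z \<in> Y" by blast
  then have "X = atom U SS z" "Y = atom U SS z" using assms(1,2) atom_eq by (metis imageE)+
  then show False using assms(3) by simp
qed

lemma atom_in_atoms:
  assumes "X \<in> atom U SS ` U" "x \<in> X"
  shows "atom U SS x = X"
  using assms atom_eq by (metis imageE)

text \<open>Both sides of every sparse rectangle become generators, at most \<open>2 * t\<close> for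
  each of at most \<open>4 ^ card SS\<close> pairs. In a pair of density d the rectangles have
  density at most \<open>\<alpha> \<le> d / 8\<close>, so the shifted tangent gains at least
  \<open>3 / 8 * d\<close> per point of the rectangles, which cover the fraction \<open>c\<close> of
  the pair.\<close>

lemma shattered_energy_increment:
  assumes U: "finite U" and SS: "finite SS"
    and Sh: "Sh \<subseteq> (atom U SS ` U) \<times> (atom U SS ` U)"
    and sh: "\<And>X Y. (X, Y) \<in> Sh \<Longrightarrow> shattered R \<alpha> c t X Y"
    and dense: "\<And>X Y. (X, Y) \<in> Sh \<Longrightarrow> 8 * \<alpha> * (real (card X) * real (card Y)) \<le> real (card (R \<inter> X \<times> Y))"
  shows "\<exists>SS'. SS \<subseteq> SS' \<and> finite SS' \<and> card SS' \<le> card SS + 2 * t * 4 ^ card SS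
    \<and> energy R U SS + 3 / 8 * c * (\<Sum>(X, Y)\<in>Sh. real (card (R \<inter> X \<times> Y))) \<le> energy R U SS'"
proof -
  let ?at = "atom U SS ` U"
  have finat: "finite ?at" and cat: "card ?at \<le> 2 ^ card SS" using card_atoms[OF SS] by auto
  have finSh: "finite Sh" using Sh finat finite_subset by blast
  have cSh: "card Sh \<le> 4 ^ card SS"
  proof -
    have "card Sh \<le> card (?at \<times> ?at)" using Sh finat by (intro card_mono) auto
    also have "\<dots> \<le> 2 ^ card SS * 2 ^ card SS" unfolding card_cartesian_product using cat by (intro mult_mono) auto
    also have "\<dots> = 4 ^ card SS" by (simp add: power_mult_distrib[symmetric])
    finally show ?thesis .
  qed
  have "\<forall>p\<in>Sh. \<exists>Q. finite Q \<and> card Q \<le> t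
     \<and> (\<forall>(A, B)\<in>Q. A \<subseteq> fst p \<and> B \<subseteq> snd p \<and> real (card (R \<inter> A \<times> B)) \<le> \<alpha> * (real (card A) * real (card B)))
     \<and> (\<forall>p\<in>Q. \<forall>q\<in>Q. p \<noteq> q \<longrightarrow> (fst p \<times> snd p) \<inter> (fst q \<times> snd q) = {})
     \<and> c * (real (card (fst p)) * real (card (snd p))) \<le> (\<Sum>(A, B)\<in>Q. real (card A) * real (card B))"
    using sh unfolding shattered_def by auto
  from bchoice[OF this] obtain Q where finQ: "\<And>p. p \<in> Sh \<Longrightarrow> finite (Q p)" and cQ: "\<And>p. p \<in> Sh \<Longrightarrow> card (Q p) \<le> t"
    and Qsub: "\<And>p r. p \<in> Sh \<Longrightarrow> r \<in> Q p \<Longrightarrow> fst r \<subseteq> fst p \<and> snd r \<subseteq> snd p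
        \<and> real (card (R \<inter> fst r \<times> snd r)) \<le> \<alpha> * (real (card (fst r)) * real (card (snd r)))"
    and Qdisj: "\<And>p r r'. p \<in> Sh \<Longrightarrow> r \<in> Q p \<Longrightarrow> r' \<in> Q p \<Longrightarrow> r \<noteq> r' \<Longrightarrow> (fst r \<times> snd r) \<inter> (fst r' \<times> snd r') = {}"
    and Qbig: "\<And>p. p \<in> Sh \<Longrightarrow> c * (real (card (fst p)) * real (card (snd p))) \<le> (\<Sum>(A, B)\<in>Q p. real (card A) * real (card B))"
    by (fastforce simp: case_prod_beta)
  define S1 where "S1 p = fst ` Q p \<union> snd ` Q p" for p
  define SS' where "SS' = SS \<union> (\<Union>p\<in>Sh. S1 p)"
  define Tp where "Tp p = (\<Union>r\<in>Q p. fst r \<times> snd r)" for p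
  define T where "T = (\<Union>p\<in>Sh. Tp p)"
  have atU: "X \<subseteq> U" "finite X" "0 < card X" if "X \<in> ?at" for X
    using that atom_sub[of U SS] card_atom_pos[OF U] finite_subset[OF atom_sub U] by auto
  have ShU: "fst p \<in> ?at" "snd p \<in> ?at" if "p \<in> Sh" for p using Sh that by auto
  have Tp_sub: "Tp p \<subseteq> fst p \<times> snd p" if "p \<in> Sh" for p
    unfolding Tp_def using Qsub[OF that] by fastforce
  have finTp: "finite (Tp p)" if "p \<in> Sh" for p
    using finite_subset[OF Tp_sub[OF that]] atU(2) ShU[OF that] by blast
  have Tp_disj: "Tp p \<inter> Tp p' = {}" if "p \<in> Sh" "p' \<in> Sh" "p \<noteq> p'" for p p'
  proof -
    have "fst p \<noteq> fst p' \<or> snd p \<noteq> snd p'" using that(3) by (simp add: prod_eq_iff)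
    then have "fst p \<inter> fst p' = {} \<or> snd p \<inter> snd p' = {}"
      using atoms_disjoint[OF ShU(1)[OF that(1)] ShU(1)[OF that(2)]]
        atoms_disjoint[OF ShU(2)[OF that(1)] ShU(2)[OF that(2)]] by blast
    then show ?thesis using Tp_sub[OF that(1)] Tp_sub[OF that(2)] by blast
  qed
  have T_U: "T \<subseteq> U \<times> U"
  proof -
    have "Tp p \<subseteq> U \<times> U" if "p \<in> Sh" for p
      using Tp_sub[OF that] atU(1)[OF ShU(1)[OF that]] atU(1)[OF ShU(2)[OF that]] by blast
    then show ?thesis unfolding T_def by blast
  qed
  have S1SS: "fst r \<in> SS'" "snd r \<in> SS'" if "p \<in> Sh" "r \<in> Q p" for p r
    using that by (auto simp: SS'_def S1_def)
  \<comment> \<open>All sides are generators, so the cell of a point decides which sides contain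
    it.\<close>
  have T_imp: "q \<in> T" if pq: "p \<in> T" "q \<in> U \<times> U" "fst q \<in> atom U SS' (fst p)" "snd q \<in> atom U SS' (snd p)" for p q
  proof -
    obtain s where s: "s \<in> Sh" "p \<in> Tp s" using pq(1) unfolding T_def by (rule UN_E)
    from s(2) obtain r where "r \<in> Q s" "p \<in> fst r \<times> snd r" unfolding Tp_def by (rule UN_E)
    with s(1) have r: "s \<in> Sh" "r \<in> Q s" "p \<in> fst r \<times> snd r" .
    then have "q \<in> fst r \<times> snd r"
      using pq(3,4) S1SS[OF r(1,2)] by (auto simp: atom_def mem_Times_iff)
    then show ?thesis using r by (auto simp: T_def Tp_def)
  qed
  have measT: "measurable_on U SS' (\<lambda>p. p \<in> T)"
    unfolding measurable_on_def
  proof (intro ballI impI)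
    fix p q assume pq: "p \<in> U \<times> U" "q \<in> U \<times> U" "fst q \<in> atom U SS' (fst p)" "snd q \<in> atom U SS' (snd p)"
    then have "fst p \<in> atom U SS' (fst q)" "snd p \<in> atom U SS' (snd q)"
      by (simp_all add: atom_def mem_Times_iff)
    then show "(q \<in> T) = (p \<in> T)" using T_imp[of p q] T_imp[of q p] pq by blast
  qed
  have finS1: "finite (S1 p)" if "p \<in> Sh" for p using finQ[OF that] by (simp add: S1_def)
  have cS1: "card (S1 p) \<le> 2 * t" if "p \<in> Sh" for p
  proof -
    have "card (S1 p) \<le> card (fst ` Q p) + card (snd ` Q p)" unfolding S1_def by (rule card_Un_le)
    also have "\<dots> \<le> card (Q p) + card (Q p)" by (intro add_mono card_image_le finQ[OF that])
    also have "\<dots> \<le> 2 * t" using cQ[OF that] by simp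
    finally show ?thesis .
  qed
  have "card SS' \<le> card SS + card (\<Union>p\<in>Sh. S1 p)" unfolding SS'_def by (rule card_Un_le)
  also have "card (\<Union>p\<in>Sh. S1 p) \<le> (\<Sum>p\<in>Sh. card (S1 p))" by (rule card_UN_le[OF finSh])
  also have "\<dots> \<le> (\<Sum>p\<in>Sh. 2 * t)" by (rule sum_mono[OF cS1])
  also have "\<dots> \<le> 2 * t * 4 ^ card SS" using cSh by simp
  finally have cSS': "card SS' \<le> card SS + 2 * t * 4 ^ card SS" by simp
  have finSS': "finite SS'" using SS finSh finS1 by (simp add: SS'_def)
  have gain: "3 / 8 * c * real (card (R \<inter> fst p \<times> snd p))
      \<le> (\<Sum>r\<in>Tp p. dens R U SS r) / 2 - ln 2 * real (card (R \<inter> Tp p))" if p: "p \<in> Sh" for p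
  proof -
    obtain X Y where XY: "p = (X, Y)" by (cases p)
    have X: "X \<in> ?at" "Y \<in> ?at" using ShU[OF p] XY by auto
    define w where "w = real (card X) * real (card Y)"
    define d where "d = real (card (R \<inter> X \<times> Y)) / w"
    have w: "0 < w" using atU(3)[OF X(1)] atU(3)[OF X(2)] by (simp add: w_def)
    have d8: "8 * \<alpha> \<le> d" using dense[of X Y] p XY w by (simp add: d_def w_def[symmetric] field_simps)
    have d0: "0 \<le> d" using w by (simp add: d_def)
    have dw: "d * w = real (card (R \<inter> X \<times> Y))" using w by (simp add: d_def)
    have "dens R U SS r = d" if "r \<in> Tp p" for r
      using Tp_sub[OF p] that XY atom_in_atoms[OF X(1)] atom_in_atoms[OF X(2)]
      by (auto simp: dens_def d_def w_def)
    then have s: "(\<Sum>r\<in>Tp p. dens R U SS r) = d * real (card (Tp p))" by simp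
    have finr: "finite (fst r \<times> snd r)" if "r \<in> Q p" for r
      using Qsub[OF p that] atU(2) X XY by (metis finite_cartesian_product finite_subset fst_conv snd_conv)
    have cT: "real (card (Tp p)) = (\<Sum>(A, B)\<in>Q p. real (card A) * real (card B))"
      unfolding Tp_def using finQ[OF p] finr Qdisj[OF p]
      by (subst card_UN_disjoint) (auto simp: card_cartesian_product case_prod_beta)
    have cRT: "real (card (R \<inter> Tp p)) \<le> \<alpha> * real (card (Tp p))"
    proof -
      have "R \<inter> Tp p = (\<Union>r\<in>Q p. R \<inter> fst r \<times> snd r)" by (auto simp: Tp_def)
      then have "card (R \<inter> Tp p) \<le> (\<Sum>r\<in>Q p. card (R \<inter> fst r \<times> snd r))"
        by (simp only: card_UN_le[OF finQ[OF p]])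
      then have "real (card (R \<inter> Tp p)) \<le> real (\<Sum>r\<in>Q p. card (R \<inter> fst r \<times> snd r))"
        by (simp only: of_nat_le_iff)
      also have "\<dots> \<le> (\<Sum>r\<in>Q p. \<alpha> * (real (card (fst r)) * real (card (snd r))))"
        unfolding of_nat_sum using Qsub[OF p] by (intro sum_mono) auto
      also have "\<dots> = \<alpha> * real (card (Tp p))" by (simp add: cT sum_distrib_left case_prod_beta)
      finally show ?thesis .
    qed
    \<comment> \<open>The bound \<open>ln 2 \<le> 1\<close> leaves
      \<open>1 / 2 - 1 / 8 = 3 / 8\<close>.\<close>
    have "ln 2 * real (card (R \<inter> Tp p)) \<le> 1 * real (card (R \<inter> Tp p))"
      using ln_le_minus_one[of 2] by (intro mult_right_mono) auto
    also have "\<dots> \<le> d / 8 * real (card (Tp p))"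
    proof -
      have "\<alpha> * real (card (Tp p)) \<le> d / 8 * real (card (Tp p))" using d8 by (intro mult_right_mono) auto
      then show ?thesis using cRT by linarith
    qed
    finally have "(\<Sum>r\<in>Tp p. dens R U SS r) / 2 - ln 2 * real (card (R \<inter> Tp p)) \<ge> 3 / 8 * (d * real (card (Tp p)))"
      using s by simp
    moreover have "d * (c * w) \<le> d * real (card (Tp p))"
      using Qbig[OF p] cT d0 XY by (intro mult_left_mono) (auto simp: w_def)
    moreover have "d * (c * w) = c * real (card (R \<inter> X \<times> Y))" using dw by (metis mult.left_commute)
    ultimately show ?thesis using XY by simp
  qed
  have sT: "(\<Sum>p\<in>T. dens R U SS p) = (\<Sum>p\<in>Sh. \<Sum>r\<in>Tp p. dens R U SS r)"
    unfolding T_def using finSh finTp Tp_disj by (intro sum.UNION_disjoint) auto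
  have cT: "real (card (R \<inter> T)) = (\<Sum>p\<in>Sh. real (card (R \<inter> Tp p)))"
  proof -
    have "R \<inter> T = (\<Union>p\<in>Sh. R \<inter> Tp p)" by (auto simp: T_def)
    also have "card \<dots> = (\<Sum>p\<in>Sh. card (R \<inter> Tp p))"
      using finSh finTp Tp_disj by (intro card_UN_disjoint) blast+
    finally show ?thesis by simp
  qed
  have "3 / 8 * c * (\<Sum>(X, Y)\<in>Sh. real (card (R \<inter> X \<times> Y))) = (\<Sum>p\<in>Sh. 3 / 8 * c * real (card (R \<inter> fst p \<times> snd p)))"
    by (simp add: sum_distrib_left case_prod_beta)
  also have "\<dots> \<le> (\<Sum>p\<in>Sh. (\<Sum>r\<in>Tp p. dens R U SS r) / 2 - ln 2 * real (card (R \<inter> Tp p)))"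
    by (rule sum_mono[OF gain])
  also have "\<dots> = (\<Sum>p\<in>T. dens R U SS p) / 2 - ln 2 * real (card (R \<inter> T))"
    unfolding sT cT by (simp add: sum_subtractf sum_distrib_left sum_divide_distrib)
  finally have "energy R U SS + 3 / 8 * c * (\<Sum>(X, Y)\<in>Sh. real (card (R \<inter> X \<times> Y))) \<le> energy R U SS'"
    using energy_increment[OF U _ T_U measT, of SS R] by (simp add: SS'_def)
  then show ?thesis using cSS' finSS' by (intro exI[of _ SS']) (auto simp: SS'_def)
qed

text \<open>There are at most \<open>2 ^ card SS\<close> cells, so those of size below
  \<open>y / 2 ^ card SS\<close> hold at most \<open>y\<close> points together.\<close>

lemma small_atoms:
  assumes U: "finite U" and SS: "finite SS"
  shows "real (card {x \<in> U. 2 ^ card SS * real (card (atom U SS x)) < y}) \<le> max 0 y"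
proof -
  let ?B = "{X \<in> atom U SS ` U. 2 ^ card SS * real (card X) < y}"
  have finB: "finite ?B" "card ?B \<le> 2 ^ card SS"
    using card_atoms[OF SS, of U] card_mono[of "atom U SS ` U" ?B] by auto
  have "{x \<in> U. 2 ^ card SS * real (card (atom U SS x)) < y} \<subseteq> \<Union> ?B"
    using atom_self by fastforce
  moreover have "finite (\<Union> ?B)"
    using finB finite_subset[OF atom_sub U] by auto
  ultimately have "real (card {x \<in> U. 2 ^ card SS * real (card (atom U SS x)) < y}) \<le> real (card (\<Union> ?B))"
    by (simp add: card_mono)
  also have "\<dots> \<le> real (\<Sum>X\<in>?B. card X)"
    using card_UN_le[OF finB(1), of "\<lambda>X. X"] by (simp del: of_nat_sum)
  also have "\<dots> \<le> (\<Sum>X\<in>?B. max 0 y / 2 ^ card SS)"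
    unfolding of_nat_sum
  proof (rule sum_mono)
    fix X assume "X \<in> ?B"
    then have "2 ^ card SS * real (card X) < y" by blast
    then have "real (card X) * 2 ^ card SS \<le> max 0 y" by (simp add: mult.commute)
    then show "real (card X) \<le> max 0 y / 2 ^ card SS" by (simp add: pos_le_divide_eq)
  qed
  also have "\<dots> = real (card ?B) * (max 0 y / 2 ^ card SS)" by simp
  also have "\<dots> \<le> 2 ^ card SS * (max 0 y / 2 ^ card SS)"
  proof (rule mult_right_mono)
    have "real (card ?B) \<le> real (2 ^ card SS)" using finB(2) by (simp only: of_nat_le_iff)
    then show "real (card ?B) \<le> 2 ^ card SS" by simp
  qed simp
  finally show ?thesis by simp
qed

text \<open>The indicator of low density is constant on rectangles of cells, so the conditional
  expectation turns this count into a sum of densities below \<open>\<theta>\<close>.\<close>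

lemma sparse_pairs:
  assumes U: "finite U" and R: "R \<subseteq> U \<times> U" and \<theta>: "0 \<le> \<theta>"
  shows "real (card {p \<in> R. dens R U SS p < \<theta>}) \<le> \<theta> * real (card U) ^ 2"
proof -
  define g where "g = (\<lambda>p. if dens R U SS p < \<theta> then 1 else 0 :: real)"
  have mg: "measurable_on U SS g"
    using measurable_on_dens[of U SS R] unfolding measurable_on_def g_def by metis
  have fin: "finite (U \<times> U)" using U by simp
  have "real (card {p \<in> R. dens R U SS p < \<theta>}) = (\<Sum>p\<in>R \<inter> U \<times> U. g p)"
  proof -
    have "R \<inter> U \<times> U = R" "finite R" using R fin finite_subset by auto
    then show ?thesis by (simp add: g_def sum.If_cases Int_def)
  qed
  also have "\<dots> = (\<Sum>p\<in>U \<times> U. dens R U SS p * g p)" using sum_dens_mult[OF U mg] by simp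
  also have "\<dots> \<le> (\<Sum>p\<in>U \<times> U. \<theta>)" using \<theta> by (intro sum_mono) (auto simp: g_def)
  also have "\<dots> = \<theta> * real (card U) ^ 2" by (simp add: card_cartesian_product power2_eq_square)
  finally show ?thesis .
qed

section \<open>The refinement step and its iteration\<close>

text \<open>\<open>N\<close> is the number of generators of the partition supplying the sides; large
  cells have size at least \<open>y / 2 ^ N\<close>.\<close>

definition rich_boxes :: "('i \<times> 'i) set \<Rightarrow> 'i set \<Rightarrow> 'a set \<Rightarrow> ('a \<times> 'a) set \<Rightarrow> nat \<Rightarrow> real \<Rightarrow> nat \<Rightarrow> bool" where
  "rich_boxes F I U R q y N \<longleftrightarrow> (\<exists>V. (\<forall>i\<in>I. V i \<subseteq> U \<and> y \<le> 2 ^ N * real (card (V i)))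
     \<and> vol I V \<le> 4 * q ^ card F * 2 ^ (2 * q ^ card F) * real (card (homs F I V R)))"

text \<open>If shattered pairs hold at least \<open>M / 2\<close> pairs of \<open>R\<close>, the
  entropy grows. Otherwise fewer than \<open>M\<close> pairs are discarded for lying in shattered
  pairs, meeting small cells or having low density, and \<open>hit\<close> places the edges of
  \<open>F\<close> among the rest. The cells of their endpoints span the box. Were it not rich, one
  edge would join cells of a shattered pair of density at least \<open>8 * \<alpha>\<close>, and so
  would have been discarded. Several vertices may share a cell.\<close>

lemma rich_boxes_or_refinement:
  fixes F :: "('i::linorder \<times> 'i) set" and q :: nat
  assumes U: "finite U" "U \<noteq> {}" and R: "R \<subseteq> U \<times> U"
    and I: "finite I" and F: "finite F" "F \<noteq> {}" "\<And>k l. (k, l) \<in> F \<Longrightarrow> k \<in> I \<and> l \<in> I \<and> k < l"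
    and q: "2 \<le> q" "16 / q \<le> \<theta>" and \<eta>: "0 \<le> \<eta>" "\<eta> \<le> 1"
    and M: "(2 * \<eta> + \<theta>) * real (card U) ^ 2 < M / 2"
    and hit: "\<And>B. B \<subseteq> R \<Longrightarrow> real (card B) < M \<Longrightarrow> \<exists>x. \<forall>(i, j)\<in>F. (x i, x j) \<in> R - B"
    and SS: "finite SS"
  shows "rich_boxes F I U R q (\<eta> * real (card U)) (card SS) \<or>
    (\<exists>SS'. finite SS' \<and> card SS' \<le> card SS + 2 * 2 ^ (2 * q ^ card F) * 4 ^ card SS
      \<and> energy R U SS + 3 * M / (32 * card F) \<le> energy R U SS')"
proof -
  define n where "n = real (card U)"
  define m where "m = card F"
  define t :: nat where "t = 2 ^ (2 * q ^ m)"
  define \<alpha> where "\<alpha> = 2 / real q"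
  let ?at = "atom U SS"
  have m: "0 < m" using F by (simp add: m_def card_gt_0_iff)
  have \<theta>: "0 \<le> \<theta>" using q by (meson divide_nonneg_nonneg of_nat_0_le_iff order_trans zero_le_numeral)
  have finR: "finite R" using R U(1) finite_subset by blast
  define Sh where "Sh = {p \<in> ?at ` U \<times> ?at ` U. shattered R \<alpha> (1 / (2 * m)) t (fst p) (snd p)
     \<and> 8 * \<alpha> * (real (card (fst p)) * real (card (snd p))) \<le> real (card (R \<inter> fst p \<times> snd p))}"
  define RS where "RS = (\<Union>p\<in>Sh. R \<inter> fst p \<times> snd p)"
  have finSh: "finite Sh" using card_atoms[OF SS, of U] by (simp add: Sh_def)
  have cRS: "real (card RS) = (\<Sum>(X, Y)\<in>Sh. real (card (R \<inter> X \<times> Y)))"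
  proof -
    have disj: "(R \<inter> fst p \<times> snd p) \<inter> (R \<inter> fst p' \<times> snd p') = {}" if "p \<in> Sh" "p' \<in> Sh" "p \<noteq> p'" for p p'
    proof -
      have "fst p \<noteq> fst p' \<or> snd p \<noteq> snd p'" using that(3) by (simp add: prod_eq_iff)
      moreover have "fst p \<in> ?at ` U" "fst p' \<in> ?at ` U" "snd p \<in> ?at ` U" "snd p' \<in> ?at ` U"
        using that by (auto simp: Sh_def)
      ultimately have "fst p \<inter> fst p' = {} \<or> snd p \<inter> snd p' = {}"
        using atoms_disjoint by metis
      then show ?thesis by blast
    qed
    have "card RS = (\<Sum>p\<in>Sh. card (R \<inter> fst p \<times> snd p))"
      unfolding RS_def using finSh finR disj by (intro card_UN_disjoint) auto
    then show ?thesis by (simp add: case_prod_beta)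
  qed
  show ?thesis
  proof (cases "M / 2 \<le> real (card RS)")
    case True
    have "\<exists>SS'. SS \<subseteq> SS' \<and> finite SS' \<and> card SS' \<le> card SS + 2 * t * 4 ^ card SS
      \<and> energy R U SS + 3 / 8 * (1 / (2 * m)) * (\<Sum>(X, Y)\<in>Sh. real (card (R \<inter> X \<times> Y))) \<le> energy R U SS'"
    proof (rule shattered_energy_increment[OF U(1) SS])
      show "Sh \<subseteq> ?at ` U \<times> ?at ` U" by (auto simp: Sh_def)
    next
      fix X Y assume "(X, Y) \<in> Sh"
      then show "shattered R \<alpha> (1 / (2 * m)) t X Y"
        "8 * \<alpha> * (real (card X) * real (card Y)) \<le> real (card (R \<inter> X \<times> Y))"
        by (simp_all add: Sh_def)
    qed
    then obtain SS' where SS': "finite SS'" "card SS' \<le> card SS + 2 * t * 4 ^ card SS"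
      "energy R U SS + 3 / 8 * (1 / (2 * m)) * (\<Sum>(X, Y)\<in>Sh. real (card (R \<inter> X \<times> Y))) \<le> energy R U SS'"
      by blast
    have "3 * M / (32 * m) = 3 / 8 * (1 / (2 * m)) * (M / 2)" by simp
    also have "\<dots> \<le> 3 / 8 * (1 / (2 * m)) * (\<Sum>(X, Y)\<in>Sh. real (card (R \<inter> X \<times> Y)))"
      using True cRS by (intro mult_left_mono) auto
    finally show ?thesis using SS' by (auto simp: t_def m_def)
  next
    case False
    define Sm where "Sm = {x \<in> U. 2 ^ card SS * real (card (?at x)) < \<eta> * n}"
    define Sp where "Sp = {p \<in> R. dens R U SS p < \<theta>}"
    \<comment> \<open>Small cells cost at most \<open>2 * \<eta> * n ^ 2\<close> and sparse pairs
      \<open>\<theta> * n ^ 2\<close>, together below \<open>M / 2\<close>; the shattered pairs stay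
      below the other half.\<close>
    define B where "B = R \<inter> (Sm \<times> U \<union> U \<times> Sm \<union> Sp \<union> RS)"
    have "real (card Sm) \<le> \<eta> * n"
      using small_atoms[OF U(1) SS, of "\<eta> * n"] \<eta> by (simp add: Sm_def n_def)
    then have cSm: "real (card Sm) * n \<le> \<eta> * n ^ 2"
      using mult_right_mono[of "real (card Sm)" "\<eta> * n" n] by (simp add: n_def power2_eq_square)
    have cSp: "real (card Sp) \<le> \<theta> * n ^ 2"
      using sparse_pairs[OF U(1) R \<theta>] by (simp add: Sp_def n_def)
    have "card B \<le> card (Sm \<times> U \<union> U \<times> Sm \<union> Sp \<union> RS)"
      unfolding B_def using U(1) finR finSh by (intro card_mono) (auto simp: Sm_def Sp_def RS_def)
    also have "\<dots> \<le> card (Sm \<times> U) + card (U \<times> Sm) + card Sp + card RS"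
      by (meson add_mono card_Un_le order_refl order_trans)
    finally have "real (card B) \<le> real (card (Sm \<times> U) + card (U \<times> Sm) + card Sp + card RS)"
      by (simp only: of_nat_le_iff)
    then have "real (card B) \<le> 2 * (real (card Sm) * n) + real (card Sp) + real (card RS)"
      by (simp add: card_cartesian_product n_def)
    also have "\<dots> < M"
      using cSm cSp M False by (simp add: n_def algebra_simps)
    finally obtain x where x: "\<And>i j. (i, j) \<in> F \<Longrightarrow> (x i, x j) \<in> R - B"
      using hit[of B] by (fastforce simp: B_def)
    \<comment> \<open>A vertex without edges is not controlled by \<open>x\<close> and receives all
      of \<open>U\<close>, which is large enough as \<open>\<eta> \<le> 1\<close>.\<close>
    define V where "V i = (if i \<in> fst ` F \<union> snd ` F then ?at (x i) else U)" for i
    have big: "\<eta> * n \<le> 2 ^ card SS * real (card (V i)) \<and> V i \<noteq> {}" for i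
    proof (cases "i \<in> fst ` F \<union> snd ` F")
      case True
      have "x k \<in> U \<and> x k \<notin> Sm \<and> x l \<in> U \<and> x l \<notin> Sm" if "(k, l) \<in> F" for k l
        using x[OF that] R unfolding B_def by blast
      then have "x i \<in> U \<and> x i \<notin> Sm" using True by force
      then show ?thesis using True atom_self[of "x i" U SS] by (auto simp: V_def Sm_def)
    next
      case False
      have "\<eta> * n \<le> 1 * n" using \<eta> by (intro mult_right_mono) (auto simp: n_def)
      also have "\<dots> \<le> 2 ^ card SS * n" by (intro mult_right_mono) (auto simp: n_def)
      finally show ?thesis using False U by (auto simp: V_def n_def)
    qed
    have subV: "V i \<subseteq> U" for i by (auto simp: V_def atom_def)
    have "vol I V \<le> 4 * q ^ card F * 2 ^ (2 * q ^ card F) * real (card (homs F I V R))"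
    proof (rule ccontr)
      assume "\<not> ?thesis"
      then obtain i j where ij: "(i, j) \<in> F" and sh: "shattered R \<alpha> (1 / (2 * m)) t (V i) (V j)"
        using shattered_or_many_homs[of I V F q R] I F q(1) big finite_subset[OF subV U(1)]
        unfolding \<alpha>_def m_def t_def by (auto simp: not_le)
      have xx: "(x i, x j) \<in> R" "(x i, x j) \<notin> B" using x[OF ij] by auto
      then have xU: "x i \<in> U" "x j \<in> U" using R by auto
      have V: "V i = ?at (x i)" "V j = ?at (x j)" using ij by (force simp: V_def)+
      have "\<theta> \<le> dens R U SS (x i, x j)" using xx by (auto simp: B_def Sp_def)
      then have "8 * \<alpha> \<le> dens R U SS (x i, x j)" using q by (simp add: \<alpha>_def)
      then have "8 * \<alpha> * (real (card (V i)) * real (card (V j))) \<le> real (card (R \<inter> V i \<times> V j))"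
        using card_atom_pos[OF U(1) xU(1), of SS] card_atom_pos[OF U(1) xU(2), of SS]
        by (simp add: dens_def V pos_le_divide_eq)
      then have "(V i, V j) \<in> Sh" using sh xU by (auto simp: Sh_def V)
      moreover have "(x i, x j) \<in> V i \<times> V j" using atom_self xU by (auto simp: V)
      ultimately have "(x i, x j) \<in> RS" using xx(1) unfolding RS_def by (intro UN_I[of "(V i, V j)"]) auto
      then show False using xx by (simp add: B_def)
    qed
    then show ?thesis using big subV by (auto simp: rich_boxes_def n_def)
  qed
qed

section \<open>Growth of the tower against growth of the partition\<close>

lemma tower_nat_ge: "Suc i \<le> tower_nat i"
proof (induction i)
  case (Suc i)
  have "tower_nat i < 2 ^ tower_nat i" by simp
  then show ?case using Suc unfolding tower_nat.simps by linarith
qed simp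

lemma tower_nat_mono: "i \<le> j \<Longrightarrow> tower_nat i \<le> tower_nat j"
proof (induction j rule: dec_induct)
  case (step j)
  have "tower_nat j < 2 ^ tower_nat j" by simp
  then show ?case using step.IH unfolding tower_nat.simps by linarith
qed simp

text \<open>The invariant reproduces itself at the price of one exponential. With
  \<open>u = 2 * N + 2 * Q + 2\<close>, twice the number of new generators is at most
  \<open>2 ^ u\<close>, so the left side grows from \<open>u + 1\<close> to at most
  \<open>u + 1 + 2 ^ u \<le> 2 ^ (u + 1)\<close>.\<close>

lemma tower_step:
  assumes w: "2 * N + (2 * Q + 3) \<le> tower_nat i" and N': "N' \<le> N + 2 * 2 ^ (2 * Q) * 4 ^ N"
  shows "2 * N' + (2 * Q + 3) \<le> tower_nat (Suc i)"
proof -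
  define u where "u = 2 * N + 2 * Q + 2"
  have "4 * 2 ^ (2 * Q) * 4 ^ N = (2 :: nat) ^ u"
    by (simp add: u_def power_add power_mult)
  then have "2 * N' + (2 * Q + 3) \<le> Suc u + 2 ^ u" using N' by (simp add: u_def)
  also have "Suc u \<le> 2 ^ u" by (simp add: Suc_le_eq)
  also have "2 ^ u + 2 ^ u = (2 :: nat) ^ Suc u" by simp
  also have "\<dots> \<le> 2 ^ tower_nat i" using w by (intro power_increasing) (auto simp: u_def)
  finally show ?thesis by simp
qed

text \<open>While no rich box appears, each refinement raises the energy by the same amount and the
  height by one; after \<open>k\<close> refinements the energy would be positive. The initial height
  \<open>j\<close> accommodates \<open>q ^ card F\<close>.\<close>

lemma rich_boxes_exist:
  fixes F :: "('i::linorder \<times> 'i) set" and q :: nat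
  assumes U: "finite U" "U \<noteq> {}" and R: "R \<subseteq> U \<times> U"
    and I: "finite I" and F: "finite F" "F \<noteq> {}" "\<And>k l. (k, l) \<in> F \<Longrightarrow> k \<in> I \<and> l \<in> I \<and> k < l"
    and q: "2 \<le> q" "16 / q \<le> \<theta>" and \<eta>: "0 \<le> \<eta>" "\<eta> \<le> 1"
    and M: "(2 * \<eta> + \<theta>) * real (card U) ^ 2 < M / 2"
    and hit: "\<And>B. B \<subseteq> R \<Longrightarrow> real (card B) < M \<Longrightarrow> \<exists>x. \<forall>(i, j)\<in>F. (x i, x j) \<in> R - B"
    and j: "2 * q ^ card F + 3 \<le> tower_nat j"
    and k: "0 < energy R U {} + real k * (3 * M / (32 * card F))"
  shows "\<exists>N. 2 * N + (2 * q ^ card F + 3) \<le> tower_nat (j + k) \<and> rich_boxes F I U R q (\<eta> * real (card U)) N"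
proof (rule ccontr)
  assume neg: "\<not> ?thesis"
  have "\<exists>SS. finite SS \<and> 2 * card SS + (2 * q ^ card F + 3) \<le> tower_nat (j + i)
      \<and> energy R U {} + real i * (3 * M / (32 * card F)) \<le> energy R U SS" if "i \<le> k" for i
    using that
  proof (induction i)
    case 0
    then show ?case using j by (intro exI[of _ "{}"]) auto
  next
    case (Suc i)
    then obtain SS where SS: "finite SS" "2 * card SS + (2 * q ^ card F + 3) \<le> tower_nat (j + i)"
      "energy R U {} + real i * (3 * M / (32 * card F)) \<le> energy R U SS" by auto
    have "tower_nat (j + i) \<le> tower_nat (j + k)" using Suc.prems by (intro tower_nat_mono) simp
    then have "\<not> rich_boxes F I U R q (\<eta> * real (card U)) (card SS)" using neg SS(2) by (meson order_trans)
    then obtain SS' where SS': "finite SS'" "card SS' \<le> card SS + 2 * 2 ^ (2 * q ^ card F) * 4 ^ card SS"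
      "energy R U SS + 3 * M / (32 * card F) \<le> energy R U SS'"
      using rich_boxes_or_refinement[OF U R I F q \<eta> M hit SS(1)] by blast
    have "2 * card SS' + (2 * q ^ card F + 3) \<le> tower_nat (j + Suc i)"
      using tower_step[OF SS(2) SS'(2)] by simp
    moreover have "energy R U {} + real (Suc i) * (3 * M / (32 * card F)) \<le> energy R U SS'"
      using SS(3) SS'(3) unfolding of_nat_Suc distrib_right by linarith
    ultimately show ?case using SS'(1) by blast
  qed
  from this[of k] show False using k energy_nonpos[OF U(1)] by (meson leD less_le_trans order_refl)
qed

lemma energy_trivial_partition:
  assumes U: "finite U" and R: "R \<subseteq> U \<times> U" "R \<noteq> {}"
  shows "energy R U {} = real (card R) * ln (real (card R) / real (card U) ^ 2)"
proof -
  have at: "atom U {} x = U" for x by (simp add: atom_def)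
  have d: "dens R U {} p = real (card R) / real (card U) ^ 2" for p
    using R by (simp add: dens_def at Int_absorb2 power2_eq_square)
  have "0 < card U" using R U by (auto simp: card_gt_0_iff)
  then show ?thesis by (simp add: energy_def d card_cartesian_product power2_eq_square)
qed

section \<open>Copies and homomorphisms\<close>

lemma simple_graph_edgeE:
  assumes "simple_graph G" "e \<in> edges G"
  obtains u v where "e = {u, v}" "u \<noteq> v" "u \<in> verts G" "v \<in> verts G"
proof -
  have "card e = 2" "e \<subseteq> verts G" using assms by (auto simp: simple_graph_def)
  then obtain u v where "e = {u, v}" "u \<noteq> v" by (auto simp: card_2_iff)
  then show ?thesis using that \<open>e \<subseteq> verts G\<close> by blast
qed

lemma finite_edges:
  assumes "simple_graph G"
  shows "finite (edges G)"
proof (rule finite_subset)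
  show "edges G \<subseteq> Pow (verts G)" using assms by (auto simp: simple_graph_def)
  show "finite (Pow (verts G))" using assms by (simp add: simple_graph_def)
qed

lemma finite_copies:
  assumes "simple_graph G"
  shows "finite (copies H G)"
proof (rule finite_subset)
  show "copies H G \<subseteq> Pow (verts G) \<times> Pow (edges G)"
    by (auto simp: copies_def subgraph_def)
  show "finite (Pow (verts G) \<times> Pow (edges G))"
    using assms finite_edges[OF assms] by (simp add: simple_graph_def)
qed

lemma copyE:
  assumes H: "simple_graph H" and K: "K \<in> copies H G"
  obtains f where "bij_betw f (verts H) (verts K)" "edges K = (`) f ` edges H"
proof -
  have sK: "simple_graph K" using K by (simp add: copies_def subgraph_def)
  obtain f where f: "bij_betw f (verts H) (verts K)"
    and e: "\<And>u v. u \<in> verts H \<Longrightarrow> v \<in> verts H \<Longrightarrow> {u, v} \<in> edges H \<longleftrightarrow> {f u, f v} \<in> edges K"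
    using K by (auto simp: copies_def graph_iso_def)
  have "edges K = (`) f ` edges H"
  proof
    show "(`) f ` edges H \<subseteq> edges K"
    proof (rule image_subsetI)
      fix a assume "a \<in> edges H"
      then obtain u v where "a = {u, v}" "u \<in> verts H" "v \<in> verts H" "{u, v} \<in> edges H"
        using simple_graph_edgeE[OF H] by metis
      then show "f ` a \<in> edges K" using e by simp
    qed
    show "edges K \<subseteq> (`) f ` edges H"
    proof
      fix a assume a: "a \<in> edges K"
      then obtain x y where xy: "a = {x, y}" "x \<in> verts K" "y \<in> verts K"
        using simple_graph_edgeE[OF sK] by metis
      then obtain u v where uv: "u \<in> verts H" "v \<in> verts H" "x = f u" "y = f v"
        using f by (metis bij_betw_def imageE)
      then have "{u, v} \<in> edges H" "f ` {u, v} = a" using e[OF uv(1,2)] a xy by auto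
      then show "a \<in> (`) f ` edges H" by blast
    qed
  qed
  then show ?thesis using f that by blast
qed

lemma card_copy_edges:
  assumes H: "simple_graph H" and K: "K \<in> copies H G"
  shows "card (edges K) = card (edges H)"
proof -
  obtain f where f: "bij_betw f (verts H) (verts K)" "edges K = (`) f ` edges H"
    using copyE[OF H K] .
  have "inj_on ((`) f) (Pow (verts H))" using f(1) by (auto simp: bij_betw_def intro: inj_on_image_Pow)
  then have "inj_on ((`) f) (edges H)" by (rule inj_on_subset) (use H in \<open>auto simp: simple_graph_def\<close>)
  then show ?thesis using f(2) by (simp add: card_image)
qed

lemma copyI:
  assumes H: "simple_graph H" and G: "simple_graph G"
    and f: "inj_on f (verts H)" "f ` verts H \<subseteq> verts G" "(`) f ` edges H \<subseteq> edges G"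
  shows "(f ` verts H, (`) f ` edges H) \<in> copies H G"
proof -
  have sub: "a \<subseteq> verts H" if "a \<in> edges H" for a using H that by (auto simp: simple_graph_def)
  have "card (f ` a) = 2" if "a \<in> edges H" for a
  proof -
    have "inj_on f a" using f(1) sub[OF that] by (rule inj_on_subset)
    then show ?thesis using H that by (simp add: card_image simple_graph_def)
  qed
  then have simp: "simple_graph (f ` verts H, (`) f ` edges H)"
    using H sub by (auto simp: simple_graph_def)
  have "{u, v} \<in> edges H \<longleftrightarrow> {f u, f v} \<in> (`) f ` edges H" if uv: "u \<in> verts H" "v \<in> verts H" for u v
  proof
    assume "{u, v} \<in> edges H"
    then show "{f u, f v} \<in> (`) f ` edges H" by (intro image_eqI[of _ _ "{u, v}"]) auto
  next
    assume "{f u, f v} \<in> (`) f ` edges H"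
    then obtain a where a: "a \<in> edges H" "f ` {u, v} = f ` a" by auto
    then have "{u, v} = a" using inj_on_image_eq_iff[OF f(1), of "{u, v}" a] uv sub[OF a(1)] by auto
    then show "{u, v} \<in> edges H" using a by simp
  qed
  then have "graph_iso H (f ` verts H, (`) f ` edges H)"
    unfolding graph_iso_def using f(1) by (intro exI[of _ f]) (auto simp: bij_betw_def)
  then show ?thesis using simp f by (simp add: copies_def subgraph_def)
qed

lemma copies_remove_edges: "K \<in> copies H (remove_edges G D) \<longleftrightarrow> K \<in> copies H G \<and> edges K \<inter> D = {}"
  by (auto simp: copies_def subgraph_def remove_edges_def)

text \<open>A copy surviving the deletion of the union of a maximal family could be added to it; it
  is not yet a member because it has an edge. So deleting the union is one of the deletions that
  \<open>x\<close> bounds.\<close>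

lemma edge_disjoint_copies:
  assumes H: "simple_graph H" "edges H \<noteq> {}" and G: "simple_graph G"
    and x: "\<And>D. makes_free H G D \<Longrightarrow> x \<le> real (card D)"
  obtains KK where "finite KK" "KK \<subseteq> copies H G" "\<And>K K'. K \<in> KK \<Longrightarrow> K' \<in> KK \<Longrightarrow> K \<noteq> K' \<Longrightarrow> edges K \<inter> edges K' = {}"
    "x \<le> real (card (\<Union> (edges ` KK)))" "card (\<Union> (edges ` KK)) = card KK * card (edges H)"
proof -
  define fam where "fam = {KK. KK \<subseteq> copies H G \<and> (\<forall>K\<in>KK. \<forall>K'\<in>KK. K \<noteq> K' \<longrightarrow> edges K \<inter> edges K' = {})}"
  have "finite fam"
    by (rule finite_subset[of _ "Pow (copies H G)"]) (auto simp: fam_def finite_copies[OF G])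
  moreover have "{} \<in> fam" by (simp add: fam_def)
  ultimately obtain KK where KK: "KK \<in> fam" and max: "\<And>LL. LL \<in> fam \<Longrightarrow> KK \<subseteq> LL \<Longrightarrow> KK = LL"
    using finite_has_maximal[of fam] by blast
  define D where "D = \<Union> (edges ` KK)"
  have sub: "KK \<subseteq> copies H G" using KK by (simp add: fam_def)
  have disj: "edges K \<inter> edges K' = {}" if "K \<in> KK" "K' \<in> KK" "K \<noteq> K'" for K K'
    using KK that by (simp add: fam_def)
  have fin: "finite KK" using sub finite_copies[OF G] finite_subset by blast
  have "makes_free H G D"
    unfolding makes_free_def is_free_def
  proof (intro conjI equals0I)
    show "D \<subseteq> edges G" using sub by (auto simp: D_def copies_def subgraph_def)
    fix K assume "K \<in> copies H (remove_edges G D)"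
    then have K: "K \<in> copies H G" "edges K \<inter> D = {}" by (simp_all add: copies_remove_edges)
    have "edges K \<noteq> {}" using copyE[OF H(1) K(1)] H(2) by (metis image_is_empty)
    then have "K \<notin> KK" using K(2) by (auto simp: D_def)
    have "edges K \<inter> edges K' = {}" if "K' \<in> KK" for K' using K(2) that by (auto simp: D_def)
    then have "insert K KK \<in> fam" using K(1) sub disj by (auto simp: fam_def)
    then show False using max[of "insert K KK"] \<open>K \<notin> KK\<close> by blast
  qed
  then have "x \<le> real (card D)" by (rule x)
  moreover have "card D = card KK * card (edges H)"
  proof -
    have "finite (edges K)" if "K \<in> KK" for K
      using sub that by (intro finite_edges) (auto simp: copies_def subgraph_def)
    then have "card D = (\<Sum>K\<in>KK. card (edges K))"
      unfolding D_def using fin disj by (intro card_UN_disjoint) auto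
    also have "\<dots> = (\<Sum>K\<in>KK. card (edges H))"
      by (rule sum.cong[OF refl], rule card_copy_edges[OF H(1), where G = G]) (use sub in blast)
    finally show ?thesis by simp
  qed
  ultimately show ?thesis using that[of KK] fin sub disj by (simp add: D_def)
qed

text \<open>Passage from labelled to unlabelled counting: an injective homomorphism has a copy as
  its image, and all maps into the vertex set of one copy number
  \<open>card (verts H) ^ card (verts H)\<close>.\<close>

lemma card_injective_maps_le_copies:
  assumes H: "simple_graph H" and G: "simple_graph G"
    and X: "\<And>x. x \<in> X \<Longrightarrow> x \<in> extensional (verts H) \<and> inj_on x (verts H) \<and> x ` verts H \<subseteq> verts G \<and> (`) x ` edges H \<subseteq> edges G"
  shows "card X \<le> card (copies H G) * card (verts H) ^ card (verts H)"
proof -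
  define C where "C = copies H G"
  define P where "P K = PiE (verts H) (\<lambda>_. verts K)" for K :: "'b ugraph"
  have finC: "finite C" using finite_copies[OF G] by (simp add: C_def)
  have finH: "finite (verts H)" using H by (simp add: simple_graph_def)
  have K: "finite (verts K) \<and> card (verts K) = card (verts H)" if "K \<in> C" for K
    using that copyE[OF H, of K G] finH unfolding C_def by (metis bij_betw_finite bij_betw_same_card)
  have cP: "card (P K) = card (verts H) ^ card (verts H) \<and> finite (P K)" if "K \<in> C" for K
    using K[OF that] finH by (auto simp: P_def card_PiE intro: finite_PiE)
  have "X \<subseteq> (\<Union>K\<in>C. P K)"
  proof
    fix x assume "x \<in> X"
    note x = X[OF this]
    then have "(x ` verts H, (`) x ` edges H) \<in> C"
      unfolding C_def by (intro copyI[OF H G]) auto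
    moreover have "x \<in> P (x ` verts H, (`) x ` edges H)"
      using x by (auto simp: P_def PiE_def)
    ultimately show "x \<in> (\<Union>K\<in>C. P K)" by blast
  qed
  then have "card X \<le> card (\<Union>K\<in>C. P K)" using finC cP by (intro card_mono) auto
  also have "\<dots> \<le> (\<Sum>K\<in>C. card (P K))" by (rule card_UN_le[OF finC])
  also have "\<dots> = card C * card (verts H) ^ card (verts H)" using cP by simp
  finally show ?thesis by (simp add: C_def)
qed

text \<open>If \<open>x i = x j\<close> with \<open>i \<noteq> j\<close>, then \<open>x\<close> is
  determined by its values off \<open>j\<close>; there are at most \<open>card I ^ 2\<close> choices
  of \<open>(i, j)\<close>.\<close>

lemma card_noninjective_maps:
  assumes I: "finite I" and U: "finite U"
  shows "card {x \<in> PiE I (\<lambda>_. U). \<not> inj_on x I} \<le> card I ^ 2 * card U ^ (card I - 1)"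
proof -
  define Y where "Y p = {x \<in> PiE I (\<lambda>_. U). x (fst p) = x (snd p)}" for p
  define D where "D = {p \<in> I \<times> I. fst p \<noteq> snd p}"
  have finP: "finite (PiE I (\<lambda>_. U))" using I U by (intro finite_PiE)
  have finD: "finite D" using I by (simp add: D_def)
  have cD: "card D \<le> card I ^ 2"
  proof -
    have "card D \<le> card (I \<times> I)" unfolding D_def using I by (intro card_mono) auto
    then show ?thesis by (simp add: card_cartesian_product power2_eq_square)
  qed
  have cY: "card (Y p) \<le> card U ^ (card I - 1)" if p: "p \<in> D" for p
  proof -
    obtain i j where ij: "p = (i, j)" "i \<in> I" "j \<in> I" "i \<noteq> j" using p by (auto simp: D_def)
    have "inj_on (\<lambda>x. restrict x (I - {j})) (Y p)"
    proof (rule inj_onI)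
      fix x y assume xy: "x \<in> Y p" "y \<in> Y p" "restrict x (I - {j}) = restrict y (I - {j})"
      have a: "x k = y k" if "k \<in> I - {j}" for k using fun_cong[OF xy(3), of k] that by simp
      have "x j = y j" using a[of i] xy ij by (simp add: Y_def)
      then have "x k = y k" if "k \<in> I" for k using a that by (cases "k = j") auto
      then show "x = y" using xy(1,2) by (auto simp: Y_def intro: PiE_ext)
    qed
    moreover have "(\<lambda>x. restrict x (I - {j})) ` Y p \<subseteq> PiE (I - {j}) (\<lambda>_. U)"
      by (auto simp: Y_def PiE_def Pi_def)
    ultimately have "card (Y p) \<le> card (PiE (I - {j}) (\<lambda>_. U))"
      using I U by (intro card_inj_on_le) (auto intro!: finite_PiE)
    also have "\<dots> = card U ^ (card I - 1)" using I ij by (simp add: card_PiE)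
    finally show ?thesis .
  qed
  have "{x \<in> PiE I (\<lambda>_. U). \<not> inj_on x I} \<subseteq> (\<Union>p\<in>D. Y p)"
    by (fastforce simp: D_def Y_def inj_on_def)
  then have "card {x \<in> PiE I (\<lambda>_. U). \<not> inj_on x I} \<le> card (\<Union>p\<in>D. Y p)"
    using finD finP by (intro card_mono) (auto simp: Y_def)
  also have "\<dots> \<le> (\<Sum>p\<in>D. card (Y p))" by (rule card_UN_le[OF finD])
  also have "\<dots> \<le> (\<Sum>p\<in>D. card U ^ (card I - 1))" by (rule sum_mono[OF cY])
  also have "\<dots> = card D * card U ^ (card I - 1)" by simp
  also have "\<dots> \<le> card I ^ 2 * card U ^ (card I - 1)" using cD by (rule mult_le_mono1)
  finally show ?thesis .
qed

section \<open>Numerical estimates\<close>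

text \<open>The height \<open>8 * L\<close> pays \<open>2 * L\<close> for reaching the initial
  parameter, \<open>4 * L\<close> for the refinements and 3 for the final count. The slack for
  rounding comes from \<open>L \<ge> 16\<close>, a consequence of \<open>h \<ge> 2\<close> and
  \<open>\<epsilon> \<le> 1 / 2\<close>.\<close>

lemma tower_height_bounds:
  fixes h m :: nat and \<epsilon> :: real
  assumes h: "2 \<le> h" and m: "0 < m" "2 * m \<le> h ^ 2" and \<epsilon>: "0 < \<epsilon>" "\<epsilon> \<le> 1 / 2"
  defines "L \<equiv> real h ^ 4 * log 2 (inverse \<epsilon>)" and "q \<equiv> nat \<lceil>64 * m / \<epsilon>\<rceil>"
  shows "2 * q ^ m + 3 \<le> tower_nat (Suc (nat \<lceil>2 * L\<rceil>))"
    and "h \<le> tower_nat (Suc (nat \<lceil>2 * L\<rceil>))"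
    and "Suc (nat \<lceil>2 * L\<rceil>) + nat \<lceil>4 * L\<rceil> + 3 \<le> nat \<lceil>8 * L\<rceil>"
proof -
  define l where "l = log 2 (inverse \<epsilon>)"
  have l: "1 \<le> l"
  proof -
    have "2 \<le> inverse \<epsilon>" using \<epsilon> by (simp add: field_simps)
    then have "log 2 2 \<le> log 2 (inverse \<epsilon>)" using \<epsilon>(1) by (subst log_le_cancel_iff) auto
    then show ?thesis by (simp add: l_def)
  qed
  have h2: "2 \<le> real h" using h by simp
  have h4: "16 \<le> real h ^ 4" using power_mono[OF h2, of 4] by simp
  have Lh: "real h ^ 4 \<le> L" using mult_left_mono[OF l, of "real h ^ 4"] by (simp add: L_def l_def)
  have L16: "16 \<le> L" using h4 Lh by simp
  have hL: "real h \<le> L"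
  proof -
    have "real h ^ 1 \<le> real h ^ 4" using h2 by (intro power_increasing) auto
    then show ?thesis using Lh unfolding power_one_right by linarith
  qed
  \<comment> \<open>Only the top exponential is used; below it, \<open>tower_nat i \<ge> i\<close>
    is enough.\<close>
  have t: "2 powr (2 * L) \<le> real (tower_nat (Suc (nat \<lceil>2 * L\<rceil>)))"
  proof -
    have "2 powr (2 * L) \<le> 2 powr real (nat \<lceil>2 * L\<rceil>)" by (intro powr_mono) (auto simp: real_nat_ceiling_ge)
    also have "\<dots> = real (2 ^ nat \<lceil>2 * L\<rceil>)" by (simp add: powr_realpow)
    also have "\<dots> \<le> real (2 ^ tower_nat (nat \<lceil>2 * L\<rceil>))"
      unfolding of_nat_le_iff by (intro power_increasing Suc_leD[OF tower_nat_ge]) simp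
    finally show ?thesis by simp
  qed
  have "real h \<le> real (nat \<lceil>2 * L\<rceil>)" using hL L16 real_nat_ceiling_ge[of "2 * L"] by linarith
  then show "h \<le> tower_nat (Suc (nat \<lceil>2 * L\<rceil>))" using tower_nat_ge[of "Suc (nat \<lceil>2 * L\<rceil>)"] by linarith
  have "real (Suc (nat \<lceil>2 * L\<rceil>) + nat \<lceil>4 * L\<rceil> + 3) < real (Suc (nat \<lceil>8 * L\<rceil>))"
    using L16 real_nat_ceiling_ge[of "8 * L"] by (simp; linarith)
  then show "Suc (nat \<lceil>2 * L\<rceil>) + nat \<lceil>4 * L\<rceil> + 3 \<le> nat \<lceil>8 * L\<rceil>" unfolding of_nat_less_iff by simp
  have m1: "1 \<le> real m" "real m \<le> real h ^ 2 / 2"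
  proof -
    have "real (2 * m) \<le> real (h ^ 2)" using m(2) by (simp only: of_nat_le_iff)
    then show "real m \<le> real h ^ 2 / 2" by simp
  qed (use m in simp)
  have q_le: "real q \<le> 2 powr (6 + 2 * h + l)"
  proof -
    have "real q \<le> 64 * m / \<epsilon> + 1" unfolding q_def using \<epsilon> m1 by (simp; linarith)
    also have "1 \<le> real m / \<epsilon>" using \<epsilon> m1 by (simp add: field_simps)
    also have "64 * m / \<epsilon> + real m / \<epsilon> = 65 * real m * inverse \<epsilon>" using \<epsilon> by (simp add: field_simps)
    also have "\<dots> \<le> 64 * (real h * real h) * inverse \<epsilon>"
      using m1 \<epsilon> by (intro mult_right_mono) (auto simp: power2_eq_square)
    also have "\<dots> \<le> 64 * (2 ^ h * 2 ^ h) * inverse \<epsilon>"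
    proof -
      have "real h \<le> real (2 ^ h)" unfolding of_nat_le_iff by (simp add: less_imp_le)
      then have "real h \<le> 2 ^ h" by simp
      then show ?thesis using \<epsilon> by (intro mult_right_mono mult_left_mono mult_mono) auto
    qed
    also have "64 * (2 ^ h * 2 ^ h) = (2 :: real) powr (6 + 2 * h)"
    proof -
      have "2 powr (6 + 2 * real h) = 2 powr 6 * 2 powr real h * 2 powr real h"
        unfolding powr_add[symmetric] by (simp add: add.commute)
      then show ?thesis by (simp add: powr_realpow)
    qed
    also have "inverse \<epsilon> = 2 powr l" using \<epsilon> by (simp add: l_def)
    finally show ?thesis by (simp add: powr_add mult_ac)
  qed
  have q0: "0 < real q"
  proof -
    have "0 < 64 * m / \<epsilon>" using \<epsilon> m1 by simp
    then show ?thesis unfolding q_def by simp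
  qed
  have "real (q ^ m) = real q powr m" using q0 by (simp add: powr_realpow)
  also have "\<dots> \<le> (2 powr (6 + 2 * h + l)) powr m" using q_le q0 by (intro powr_mono2) auto
  also have "\<dots> = 2 powr ((6 + 2 * h + l) * m)" by (simp add: powr_powr)
  \<comment> \<open>By \<open>m \<le> h ^ 2 / 2\<close> the exponent is at most
    \<open>3 * h ^ 2 + h ^ 3 + h ^ 2 * l / 2\<close>; against \<open>L = h ^ 4 * l\<close> the terms
    have shares 3/4, 1/2 and 1/8.\<close>
  also have "\<dots> \<le> 2 powr (11 / 8 * L)"
  proof (rule powr_mono)
    have "(6 + 2 * h + l) * m \<le> (6 + 2 * h + l) * (real h ^ 2 / 2)"
      using m1 l by (intro mult_left_mono) auto
    also have "\<dots> = 3 * real h ^ 2 + real h ^ 3 + real h ^ 2 * l / 2"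
      by (simp add: algebra_simps power2_eq_square power3_eq_cube)
    also have "real h ^ 2 * l / 2 \<le> L / 8"
    proof -
      have "4 \<le> real h ^ 2" using power_mono[OF h2, of 2] by simp
      then have "4 * (real h ^ 2 * l) \<le> real h ^ 2 * (real h ^ 2 * l)" using l by (intro mult_right_mono) auto
      then show ?thesis by (simp add: L_def l_def power4_eq_xxxx power2_eq_square)
    qed
    also have "real h ^ 3 \<le> L / 2"
    proof -
      have "2 * real h ^ 3 \<le> real h * real h ^ 3" using h2 by (intro mult_right_mono) auto
      then show ?thesis using Lh by (simp add: power4_eq_xxxx power3_eq_cube)
    qed
    also have "3 * real h ^ 2 \<le> 3 * L / 4"
    proof -
      have "4 \<le> real h ^ 2" using power_mono[OF h2, of 2] by simp
      then have "4 * real h ^ 2 \<le> real h ^ 2 * real h ^ 2" by (intro mult_right_mono) auto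
      then show ?thesis using Lh by (simp add: power4_eq_xxxx power2_eq_square)
    qed
    finally show "(6 + 2 * h + l) * m \<le> 11 / 8 * L" by simp
  qed simp
  finally have qm: "real (q ^ m) \<le> 2 powr (11 / 8 * L)" .
  have "1 \<le> real (q ^ m)" using q0 by (simp add: Suc_le_eq)
  then have "real (2 * q ^ m + 3) \<le> 2 ^ 3 * real (q ^ m)" by simp
  also have "\<dots> \<le> 2 powr 3 * 2 powr (11 / 8 * L)" using qm by simp
  also have "\<dots> = 2 powr (3 + 11 / 8 * L)" by (simp add: powr_add)
  also have "\<dots> \<le> 2 powr (2 * L)" using L16 by (intro powr_mono) auto
  also note t
  finally show "2 * q ^ m + 3 \<le> tower_nat (Suc (nat \<lceil>2 * L\<rceil>))" by (simp only: of_nat_le_iff)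
qed

text \<open>\<open>X\<close> counts homomorphisms, \<open>c\<close> copies. For large
  \<open>n\<close> the non-injective maps are absorbed; for small \<open>n\<close> the quantity
  \<open>n ^ h\<close> is itself bounded and one copy is enough, hence \<open>1 \<le> c\<close>.
  Either way the loss is \<open>2 ^ Z\<close> with \<open>Z\<close> cubic in \<open>\<tau>\<close>,
  which three exponentials over \<open>\<tau>\<close> dominate.\<close>

lemma count_from_homs:
  fixes n h X N Q \<tau> c :: nat
  assumes \<tau>: "2 * N + (2 * Q + 3) \<le> \<tau>" "h \<le> \<tau>" and Q: "1 \<le> Q" and h: "0 < h"
    and X: "n ^ h \<le> Q ^ h * 2 ^ (N * h) * (4 * Q * 2 ^ (2 * Q)) * X"
    and Xc: "X \<le> c * h ^ h + h ^ 2 * n ^ (h - 1)" and c: "1 \<le> c"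
  shows "n ^ h \<le> 2 ^ 2 ^ 2 ^ \<tau> * c"
proof -
  define A where "A = \<tau> * \<tau> + 2 * \<tau>"
  define Z where "Z = A * \<tau> + 2 * \<tau> * \<tau> + \<tau>"
  have \<tau>5: "5 \<le> \<tau>" using \<tau> Q by simp
  have pow: "k \<le> (2 :: nat) ^ k" for k by (simp add: less_imp_le)
  have ht: "h \<le> 2 ^ \<tau>" using \<tau>(2) pow[of \<tau>] by linarith
  have Z: "Z \<le> 2 ^ 2 ^ \<tau>"
  proof -
    have "Z = \<tau> * \<tau> * \<tau> + 4 * (\<tau> * \<tau>) + \<tau>" by (simp add: Z_def A_def algebra_simps)
    moreover have "\<tau> * \<tau> \<le> \<tau> * \<tau> * \<tau>" "\<tau> \<le> \<tau> * \<tau> * \<tau>" using \<tau>5 by auto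
    ultimately have "Z \<le> 8 * (\<tau> * \<tau> * \<tau>)" by linarith
    also have "\<dots> \<le> 8 * (2 ^ \<tau> * 2 ^ \<tau> * 2 ^ \<tau>)" using pow[of \<tau>] by (intro mult_le_mono) auto
    also have "\<dots> = 2 ^ (3 + 3 * \<tau>)" by (simp add: power_add mult_2 numeral_3_eq_3)
    also have "\<dots> \<le> 2 ^ 2 ^ \<tau>"
    proof (rule power_increasing)
      show "3 + 3 * \<tau> \<le> 2 ^ \<tau>" using \<tau>5 by (induction \<tau> rule: dec_induct) auto
    qed simp
    finally show ?thesis .
  qed
  have "Q ^ h * 2 ^ (N * h) * (4 * Q * 2 ^ (2 * Q)) \<le> (2 ^ Q) ^ h * 2 ^ (N * h) * (2 ^ 2 * 2 ^ Q * 2 ^ (2 * Q))"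
    using pow[of Q] by (intro mult_le_mono power_mono) auto
  also have "\<dots> = 2 ^ ((Q + N) * h + (2 + Q + 2 * Q))"
    by (simp add: power_add power_mult power2_eq_square power3_eq_cube algebra_simps)
  also have "\<dots> \<le> 2 ^ A"
  proof (rule power_increasing)
    have "(Q + N) * h \<le> \<tau> * \<tau>" using \<tau> by (intro mult_le_mono) auto
    then show "(Q + N) * h + (2 + Q + 2 * Q) \<le> A" using \<tau> by (simp add: A_def)
  qed simp
  finally have "n ^ h \<le> 2 ^ A * X" using X by (meson mult_le_mono1 order_trans)
  also have "\<dots> \<le> 2 ^ A * (c * h ^ h + h ^ 2 * n ^ (h - 1))" using Xc by simp
  finally have main: "n ^ h \<le> 2 ^ A * (c * h ^ h) + 2 ^ A * h ^ 2 * n ^ (h - 1)" by (simp add: algebra_simps)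
  have "n ^ h \<le> 2 ^ Z * c"
  proof (cases "2 * (2 ^ A * h ^ 2) \<le> n")
    case True
    \<comment> \<open>In this range the non-injective term is at most half of \<open>n ^ h\<close>
      and moves to the left side.\<close>
    have "2 * (2 ^ A * h ^ 2) * n ^ (h - 1) \<le> n * n ^ (h - 1)" using True by (rule mult_le_mono1)
    also have "\<dots> = n ^ h" using h by (simp add: power_eq_if)
    finally have "n ^ h \<le> 2 * 2 ^ A * (c * h ^ h)" using main by simp
    also have "h ^ h \<le> (2 ^ \<tau>) ^ \<tau>"
    proof -
      have "h ^ h \<le> (2 ^ \<tau>) ^ h" using ht by (rule power_mono) simp
      also have "\<dots> \<le> (2 ^ \<tau>) ^ \<tau>" using \<tau>(2) by (intro power_increasing) auto
      finally show ?thesis .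
    qed
    also have "2 * 2 ^ A * (c * (2 ^ \<tau>) ^ \<tau>) = 2 ^ (1 + A + \<tau> * \<tau>) * c"
      by (simp add: power_add power_mult)
    also have "\<dots> \<le> 2 ^ Z * c"
    proof (intro mult_le_mono1 power_increasing)
      have "A \<le> A * \<tau>" "\<tau> * \<tau> \<le> 2 * \<tau> * \<tau>" using \<tau>5 by auto
      then show "1 + A + \<tau> * \<tau> \<le> Z" using \<tau>5 unfolding Z_def by linarith
    qed simp
    finally show ?thesis by simp
  next
    case False
    then have "n \<le> 2 * (2 ^ A * h ^ 2)" by simp
    also have "\<dots> \<le> 2 * (2 ^ A * (2 ^ \<tau>) ^ 2)" using ht by (intro mult_le_mono2 power_mono) auto
    also have "\<dots> = 2 ^ (A + 2 * \<tau> + 1)" by (simp add: power_add power_mult[symmetric] mult.commute)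
    finally have "n ^ h \<le> (2 ^ (A + 2 * \<tau> + 1)) ^ h" by (rule power_mono) simp
    also have "\<dots> \<le> (2 ^ (A + 2 * \<tau> + 1)) ^ \<tau>" using \<tau>(2) by (intro power_increasing) auto
    also have "\<dots> = 2 ^ Z"
    proof -
      have "(A + 2 * \<tau> + 1) * \<tau> = Z" by (simp add: Z_def algebra_simps)
      then show ?thesis by (simp only: power_mult[symmetric])
    qed
    also have "\<dots> \<le> 2 ^ Z * c" using c by simp
    finally show ?thesis .
  qed
  also have "\<dots> \<le> 2 ^ 2 ^ 2 ^ \<tau> * c" using Z by (intro mult_le_mono1 power_increasing) auto
  finally show ?thesis .
qed

section \<open>Ordered pairs against unordered edges, and the edgeless case\<close>

lemma card_symmetric_pairs:
  assumes "finite E" "\<And>e. e \<in> E \<Longrightarrow> card e = 2"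
  shows "card {(x, y). {x, y} \<in> E} = 2 * card E"
proof -
  have pair: "{p. {fst p, snd p} = {a, b}} = {(a, b), (b, a)}" for a b :: 'a
    by (auto simp: doubleton_eq_iff)
  have c: "finite {p. {fst p, snd p} = e} \<and> card {p. {fst p, snd p} = e} = 2" if e: "e \<in> E" for e
  proof -
    obtain a b where "e = {a, b}" "a \<noteq> b" using assms(2)[OF e] by (auto simp: card_2_iff)
    then show ?thesis by (simp add: pair)
  qed
  have "{(x, y). {x, y} \<in> E} = (\<Union>e\<in>E. {p. {fst p, snd p} = e})" by auto
  also have "card \<dots> = (\<Sum>e\<in>E. card {p. {fst p, snd p} = e})"
    using assms(1) c by (intro card_UN_disjoint) auto
  also have "\<dots> = 2 * card E" using c by simp
  finally show ?thesis .
qed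

text \<open>Deleting edges does not affect copies of an edgeless graph. So a successful deletion
  means that there was no copy at all; then deleting nothing succeeds as well and forces
  \<open>\<epsilon> * n ^ 2 \<le> 0\<close>. An empty \<open>H\<close> would always have a
  copy.\<close>

lemma no_removal_without_edges:
  assumes H: "simple_graph H" "edges H = {}" and G: "simple_graph G" and n: "card (verts G) = n"
    and removal: "needs_removal H G (\<epsilon> * real n ^ 2)" and \<epsilon>: "\<epsilon> > 0"
  shows "n = 0 \<and> verts H \<noteq> {}"
proof -
  have noinj: "\<not> (inj_on f (verts H) \<and> f ` verts H \<subseteq> verts G)" for f
  proof
    assume f: "inj_on f (verts H) \<and> f ` verts H \<subseteq> verts G"
    have K: "(f ` verts H, (`) f ` edges H) \<in> copies H G"
      using f H(2) by (intro copyI[OF H(1) G]) auto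
    obtain D where "makes_free H G D" using removal by (auto simp: needs_removal_def)
    moreover have "(f ` verts H, (`) f ` edges H) \<in> copies H (remove_edges G D)"
      using K H(2) by (simp add: copies_remove_edges)
    ultimately show False by (auto simp: makes_free_def is_free_def)
  qed
  have "copies H (remove_edges G {}) = {}"
  proof (rule equals0I)
    fix K assume K: "K \<in> copies H (remove_edges G {})"
    then obtain f where "bij_betw f (verts H) (verts K)" using copyE[OF H(1)] by metis
    moreover have "verts K \<subseteq> verts G" using K by (auto simp: copies_def subgraph_def remove_edges_def)
    ultimately show False using noinj[of f] by (auto simp: bij_betw_def)
  qed
  then have "makes_free H G {}" by (simp add: makes_free_def is_free_def)
  then have "\<epsilon> * real n ^ 2 \<le> 0" using removal by (force simp: needs_removal_def)
  then have "n = 0" using \<epsilon> by (simp add: mult_le_0_iff)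
  moreover have "verts H \<noteq> {}" using noinj by (metis empty_subsetI image_empty inj_on_empty)
  ultimately show ?thesis by simp
qed

text \<open>Each edge is recorded once, in the order of its endpoints, so that
  \<open>homs_fibres\<close> never meets the reverse of a new edge. \<open>F\<close> and its reverse
  are disjoint in the square of the vertex set, which gives the last inequality.\<close>

lemma oriented_edges:
  fixes H :: "'b::linorder ugraph"
  assumes H: "simple_graph H"
  defines "F \<equiv> {(i, j). i < j \<and> {i, j} \<in> edges H}"
  shows "finite F" "card F = card (edges H)" "edges H = (\<lambda>(i, j). {i, j}) ` F"
    and "\<And>i j. (i, j) \<in> F \<Longrightarrow> i \<in> verts H \<and> j \<in> verts H \<and> i < j"
    and "2 * card F \<le> card (verts H) ^ 2"
proof -
  have V: "i \<in> verts H \<and> j \<in> verts H \<and> i < j" if "(i, j) \<in> F" for i j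
    using H that by (auto simp: F_def simple_graph_def)
  then show "\<And>i j. (i, j) \<in> F \<Longrightarrow> i \<in> verts H \<and> j \<in> verts H \<and> i < j" .
  have finV: "finite (verts H)" using H by (simp add: simple_graph_def)
  have sub: "F \<subseteq> verts H \<times> verts H" using V by auto
  then show fin: "finite F" using finV finite_subset by blast
  show im: "edges H = (\<lambda>(i, j). {i, j}) ` F"
  proof
    show "edges H \<subseteq> (\<lambda>(i, j). {i, j}) ` F"
    proof
      fix e assume e: "e \<in> edges H"
      then obtain u v where uv: "e = {u, v}" "u \<noteq> v" using simple_graph_edgeE[OF H] by metis
      then consider "(u, v) \<in> F" | "(v, u) \<in> F" using e by (auto simp: F_def insert_commute neq_iff)
      then show "e \<in> (\<lambda>(i, j). {i, j}) ` F"
        by cases (use uv in \<open>force simp: insert_commute\<close>)+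
    qed
  qed (auto simp: F_def)
  have "inj_on (\<lambda>(i, j). {i, j}) F" by (auto simp: inj_on_def F_def doubleton_eq_iff)
  then show "card F = card (edges H)" using im by (simp add: card_image)
  have "p \<notin> prod.swap ` F" if "p \<in> F" for p
  proof
    assume "p \<in> prod.swap ` F"
    then obtain a b where "p = (a, b)" "(b, a) \<in> F" by auto
    then show False using V[of a b] V[of b a] that by auto
  qed
  then have "F \<inter> prod.swap ` F = {}" by blast
  then have "card F + card (prod.swap ` F) = card (F \<union> prod.swap ` F)"
    using fin by (intro card_Un_disjoint[symmetric]) auto
  also have "\<dots> \<le> card (verts H \<times> verts H)"
    using sub finV by (intro card_mono) auto
  finally show "2 * card F \<le> card (verts H) ^ 2"
    by (simp add: card_image card_cartesian_product power2_eq_square)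
qed

theorem theorem2p1:
  fixes H :: "nat ugraph" and G :: "'a ugraph"
    and h m n :: nat and \<epsilon> \<delta> :: real
  assumes "simple_graph H" and "verts H = {1..h}" and "card (edges H) = m"
    and "\<epsilon> > 0"
    and "inverse \<delta> = real (tower \<lceil>8 * real h ^ 4 * log 2 (inverse \<epsilon>)\<rceil>)"
    and "simple_graph G" and "card (verts G) = n"
    and "needs_removal H G (\<epsilon> * real n ^ 2)"
  shows "real (card (copies H G)) \<ge> \<delta> * real n ^ h"
proof -
  note H = assms(1) and VH = assms(2) and mH = assms(3) and \<epsilon> = assms(4) and \<delta> = assms(5)
    and G = assms(6) and nG = assms(7) and removal = assms(8)
  show ?thesis
  proof (cases "edges H = {} \<or> n = 0")
    case True
    \<comment> \<open>The claim is then trivial, as \<open>0 ^ h = 0\<close>.\<close>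
    have "n = 0 \<and> 0 < h"
    proof (cases "edges H = {}")
      case True
      then show ?thesis using no_removal_without_edges[OF H True G nG removal \<epsilon>] VH by auto
    next
      case False
      then have "0 < h" using H VH by (auto simp: simple_graph_def)
      then show ?thesis using True False by simp
    qed
    then show ?thesis by (auto simp: zero_power)
  next
    case False
    define I where "I = verts H"
    define U where "U = verts G"
    define F where "F = {(i, j). i < j \<and> {i, j} \<in> edges H}"
    note oF = oriented_edges[OF H, folded F_def]
    have cF: "card F = m" using oF(2) mH by simp
    have finI: "finite I" "card I = h" using VH by (auto simp: I_def)
    have finU: "finite U" "card U = n" using G nG by (auto simp: U_def simple_graph_def)
    have n: "0 < n" "U \<noteq> {}" using False finU by auto
    have m: "0 < m" using False finite_edges[OF H] card_gt_0_iff[of "edges H"] unfolding mH by blast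
    have m2: "2 * m \<le> h ^ 2" using oF(5) cF finI by (simp add: I_def)
    have h: "2 \<le> h"
    proof (rule ccontr)
      assume "\<not> 2 \<le> h"
      then have "h = 0 \<or> h = 1" by auto
      then show False using m m2 by auto
    qed
    have Fne: "F \<noteq> {}" using m cF by auto
    obtain KK where KK: "finite KK" "KK \<subseteq> copies H G"
      and disj: "\<And>K K'. K \<in> KK \<Longrightarrow> K' \<in> KK \<Longrightarrow> K \<noteq> K' \<Longrightarrow> edges K \<inter> edges K' = {}"
      and big: "\<epsilon> * real n ^ 2 \<le> real (card (\<Union> (edges ` KK)))"
      and cKK: "card (\<Union> (edges ` KK)) = card KK * card (edges H)"
      using edge_disjoint_copies[OF H _ G, of "\<epsilon> * real n ^ 2"] False removal
      by (auto simp: needs_removal_def)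
    define E where "E = \<Union> (edges ` KK)"
    define M where "M = real (card KK)"
    define R where "R = {(x, y). {x, y} \<in> E}"
    have EG: "E \<subseteq> edges G" using KK(2) by (auto simp: E_def copies_def subgraph_def)
    have finE: "finite E" using EG finite_edges[OF G] finite_subset by blast
    have RU: "R \<subseteq> U \<times> U"
    proof -
      have "{x, y} \<subseteq> U" if "{x, y} \<in> E" for x y
        using that EG G unfolding U_def simple_graph_def by blast
      then show ?thesis by (auto simp: R_def)
    qed
    have cE: "real (card E) = M * m" using cKK mH by (simp add: E_def M_def)
    have "card R = 2 * card E"
      unfolding R_def using finE EG G by (intro card_symmetric_pairs) (auto simp: simple_graph_def)
    then have cR: "real (card R) = 2 * M * m" using cE by simp
    have Mm: "\<epsilon> * real n ^ 2 \<le> M * m" using big cE by (simp add: E_def)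
    have en: "0 < \<epsilon> * real n ^ 2" using \<epsilon> n by simp
    have M: "0 < M" using en Mm m by (metis M_def less_le_trans mult_zero_left of_nat_0_le_iff order_le_less)
    \<comment> \<open>\<open>R\<close> contains both orientations of at least
      \<open>\<epsilon> * n ^ 2\<close> edges and has density at most 1.\<close>
    have \<epsilon>2: "\<epsilon> \<le> 1 / 2"
    proof -
      have "card R \<le> card (U \<times> U)" using RU finU by (intro card_mono) auto
      then have "real (card R) \<le> real (n * n)" unfolding card_cartesian_product finU of_nat_le_iff .
      then have "2 * \<epsilon> * real n ^ 2 \<le> 1 * real n ^ 2" using cR Mm by (simp add: power2_eq_square)
      then have "2 * \<epsilon> \<le> 1" by (rule mult_right_le_imp_le) (use n in simp)
      then show ?thesis by simp
    qed
    define L where "L = real h ^ 4 * log 2 (inverse \<epsilon>)"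
    \<comment> \<open>Chosen to give \<open>16 / q \<le> \<theta>\<close> and
      \<open>1 / q \<le> \<eta>\<close>; with these \<open>\<theta>\<close> and
      \<open>\<eta>\<close>, the budget for small cells and sparse pairs is at most
      \<open>3 / 8 * M\<close>.\<close>
    define q where "q = nat \<lceil>64 * m / \<epsilon>\<rceil>"
    define j where "j = Suc (nat \<lceil>2 * L\<rceil>)"
    define k where "k = nat \<lceil>4 * L\<rceil>"
    define \<theta> where "\<theta> = \<epsilon> / (4 * m)"
    define \<eta> where "\<eta> = \<epsilon> / (16 * m)"
    note heights = tower_height_bounds[OF h m m2 \<epsilon> \<epsilon>2, folded L_def, folded q_def j_def k_def]
    have q64: "64 * m / \<epsilon> \<le> real q" unfolding q_def by (rule real_nat_ceiling_ge)
    have m1: "1 \<le> real m" using m by simp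
    have q: "2 \<le> q"
    proof -
      have "64 * \<epsilon> \<le> 64 * real m" using \<epsilon>2 m1 by simp
      then have "64 \<le> 64 * m / \<epsilon>" using \<epsilon> by (simp add: pos_le_divide_eq)
      then show ?thesis using q64 by linarith
    qed
    have q\<theta>: "16 / q \<le> \<theta>"
      using q64 q \<epsilon> m1 by (simp add: \<theta>_def field_simps)
    have q\<eta>: "1 \<le> q * \<eta>"
      using q64 q \<epsilon> m1 by (simp add: \<eta>_def field_simps)
    have \<eta>: "0 \<le> \<eta>" "\<eta> \<le> 1" using \<epsilon> \<epsilon>2 m1 by (auto simp: \<eta>_def field_simps)
    have Msmall: "(2 * \<eta> + \<theta>) * real (card U) ^ 2 < M / 2"
    proof -
      have "(2 * \<eta> + \<theta>) * real (card U) ^ 2 = 3 / 8 * ((\<epsilon> * real n ^ 2) / m)"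
        using m1 by (simp add: \<eta>_def \<theta>_def finU field_simps)
      also have "\<dots> \<le> 3 / 8 * M" using Mm m1 by (simp add: pos_divide_le_eq)
      also have "\<dots> < M / 2" using M by simp
      finally show ?thesis .
    qed
    \<comment> \<open>Fewer than \<open>M\<close> pairs cannot meet all \<open>M\<close>
      edge-disjoint copies, so one copy is untouched; its isomorphism from \<open>H\<close> serves
      as \<open>x\<close>.\<close>
    have hit: "\<exists>x. \<forall>(i, j)\<in>F. (x i, x j) \<in> R - B" if B: "B \<subseteq> R" "real (card B) < M" for B
    proof -
      define B' where "B' = (\<lambda>(x, y). {x, y}) ` B"
      have finB: "finite B" using B(1) RU finU(1) by (meson finite_SigmaI finite_subset)
      have cB': "card B' < card KK" using card_image_le[OF finB, of "\<lambda>(x, y). {x, y}"] B(2) by (simp add: B'_def M_def)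
      have "\<exists>K\<in>KK. edges K \<inter> B' = {}"
      proof (rule ccontr)
        assume "\<not> ?thesis"
        then have "\<forall>K\<in>KK. \<exists>e. e \<in> edges K \<inter> B'" by blast
        then obtain e where e: "\<And>K. K \<in> KK \<Longrightarrow> e K \<in> edges K \<inter> B'" by metis
        have "inj_on e KK"
        proof (rule inj_onI, rule ccontr)
          fix K K' assume "K \<in> KK" "K' \<in> KK" "e K = e K'" "K \<noteq> K'"
          then show False using disj[of K K'] e[of K] e[of K'] by auto
        qed
        then have "card KK \<le> card B'" using e finB by (intro card_inj_on_le[of e]) (auto simp: B'_def)
        then show False using cB' by simp
      qed
      then obtain K where K: "K \<in> KK" "edges K \<inter> B' = {}" by blast
      have "K \<in> copies H G" using K(1) KK(2) by blast
      then obtain f where f: "edges K = (`) f ` edges H" by (rule copyE[OF H])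
      have "(f i, f j) \<in> R - B" if "(i, j) \<in> F" for i j
      proof -
        have "{i, j} \<in> edges H" using that by (simp add: F_def)
        then have "f ` {i, j} \<in> edges K" unfolding f by (rule imageI)
        then have fe: "{f i, f j} \<in> edges K" by simp
        then have "{f i, f j} \<notin> B'" using K(2) by blast
        then have "(f i, f j) \<notin> B" unfolding B'_def by force
        moreover have "(f i, f j) \<in> R" using fe K(1) by (auto simp: R_def E_def)
        ultimately show ?thesis by simp
      qed
      then show ?thesis by blast
    qed
    have energy: "0 < energy R U {} + real k * (3 * M / (32 * card F))"
    proof -
      define l where "l = log 2 (inverse \<epsilon>)"
      have Rpos: "0 < real (card R)" using cR M m1 by simp
      have "2 * \<epsilon> \<le> real (card R) / real n ^ 2" using cR Mm n by (simp add: pos_le_divide_eq)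
      then have "ln (2 * \<epsilon>) \<le> ln (real (card R) / real n ^ 2)" using \<epsilon> by (intro ln_mono) auto
      moreover have "ln (2 * \<epsilon>) = - ((l - 1) * ln 2)"
      proof -
        have "ln (inverse \<epsilon>) = l * ln 2" by (simp add: l_def log_def)
        then show ?thesis using \<epsilon> by (simp add: ln_mult ln_inverse algebra_simps)
      qed
      \<comment> \<open>With \<open>ln 2 \<le> 3 / 4\<close> the number of steps comes out as
        \<open>16 * m ^ 2 * l\<close>.\<close>
      moreover have "(l - 1) * ln 2 \<le> (l - 1) * (3 / 4)"
      proof (rule mult_left_mono)
        have "1 + 3 / 4 + (3 / 4)\<^sup>2 / 2 \<le> exp (3 / 4 :: real)" by (rule exp_lower_Taylor_quadratic) simp
        then have "2 \<le> exp (3 / 4 :: real)" by (simp add: power2_eq_square)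
        then show "ln 2 \<le> (3 / 4 :: real)" by (metis ln_le_cancel_iff exp_gt_zero ln_exp zero_less_numeral)
        have "2 \<le> inverse \<epsilon>" using \<epsilon> \<epsilon>2 by (simp add: field_simps)
        then have "log 2 2 \<le> log 2 (inverse \<epsilon>)" using \<epsilon> by (subst log_le_cancel_iff) auto
        then show "0 \<le> l - 1" by (simp add: l_def)
      qed
      ultimately have "- ((l - 1) * (3 / 4)) \<le> ln (real (card R) / real n ^ 2)" by linarith
      then have "real (card R) * - ((l - 1) * (3 / 4)) \<le> real (card R) * ln (real (card R) / real n ^ 2)"
        by (rule mult_left_mono) simp
      moreover have "R \<noteq> {}" using Rpos by auto
      note energy_trivial_partition[OF finU(1) RU this, unfolded finU]
      ultimately have e0: "real (card R) * - ((l - 1) * (3 / 4)) \<le> energy R U {}"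
        by linarith
      have "real (card R) * (l * (3 / 4)) \<le> real k * (3 * M / (32 * card F))"
      proof -
        have "real (2 * m) \<le> real (h ^ 2)" using m2 by (simp only: of_nat_le_iff)
        then have "(2 * real m) ^ 2 \<le> (real h ^ 2) ^ 2" by (intro power_mono) auto
        then have "4 * real m ^ 2 \<le> real h ^ 4" by (simp add: power_mult_distrib)
        moreover have "0 \<le> l" using \<open>(l - 1) * ln 2 \<le> (l - 1) * (3 / 4)\<close> \<epsilon> \<epsilon>2
          unfolding l_def by (simp add: zero_le_log_cancel_iff field_simps)
        ultimately have "4 * real m ^ 2 * l \<le> L" unfolding L_def l_def[symmetric] by (rule mult_right_mono)
        also have "4 * L \<le> real k" unfolding k_def by (rule real_nat_ceiling_ge)
        finally have "16 * real m ^ 2 * l \<le> real k" by simp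
        then have "16 * real m ^ 2 * l * (3 * M / (32 * m)) \<le> real k * (3 * M / (32 * m))"
          using M by (intro mult_right_mono) auto
        moreover have "16 * real m ^ 2 * l * (3 * M / (32 * m)) = real (card R) * (l * (3 / 4))"
          using m1 by (simp add: cR power2_eq_square)
        ultimately show ?thesis by (simp only: cF)
      qed
      \<comment> \<open>Counting both orientations gave \<open>ln (2 * \<epsilon>)\<close>, hence
        \<open>l - 1\<close> instead of \<open>l\<close>; this unit makes the inequality
        strict.\<close>
      moreover have "real (card R) * (l * (3 / 4)) + real (card R) * - ((l - 1) * (3 / 4)) = real (card R) * (3 / 4)"
        by (simp add: field_simps)
      ultimately show ?thesis using e0 Rpos by linarith
    qed
    have "\<exists>N. 2 * N + (2 * q ^ card F + 3) \<le> tower_nat (j + k) \<and> rich_boxes F I U R q (\<eta> * real (card U)) N"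
    proof (rule rich_boxes_exist[OF finU(1) n(2) RU finI(1) oF(1) Fne _ q q\<theta> \<eta> Msmall hit _ energy])
      show "a \<in> I \<and> b \<in> I \<and> a < b" if "(a, b) \<in> F" for a b
        using oF(4)[OF that] by (simp add: I_def)
      show "2 * q ^ card F + 3 \<le> tower_nat j" using heights(1) by (simp only: cF)
    qed
    then obtain N where N: "2 * N + (2 * q ^ m + 3) \<le> tower_nat (j + k)" and "rich_boxes F I U R q (\<eta> * n) N"
      unfolding cF finU by blast
    from this(2) obtain V where V': "(\<forall>i\<in>I. V i \<subseteq> U \<and> \<eta> * n \<le> 2 ^ N * real (card (V i)))
        \<and> vol I V \<le> 4 * real q ^ m * 2 ^ (2 * q ^ m) * real (card (homs F I V R))"
      unfolding rich_boxes_def cF by (rule exE)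
    then have V: "\<And>i. i \<in> I \<Longrightarrow> V i \<subseteq> U" "\<And>i. i \<in> I \<Longrightarrow> \<eta> * n \<le> 2 ^ N * real (card (V i))"
      by simp_all
    note vol = conjunct2[OF V']
    define X where "X = homs F I V R"
    have XP: "X \<subseteq> PiE I (\<lambda>_. U)" using V(1) PiE_mono[of I V "\<lambda>_. U"] by (auto simp: X_def homs_def)
    have finX: "finite X" using XP finI finU by (meson finite_PiE finite_subset)
    have "n ^ h \<le> q ^ h * 2 ^ (N * h) * (4 * q ^ m * 2 ^ (2 * q ^ m)) * card X"
    proof -
      \<comment> \<open>By \<open>q * \<eta> \<ge> 1\<close> each side contains at least the
        fraction \<open>1 / (q * 2 ^ N)\<close> of all vertices.\<close>
      have "real n \<le> q * 2 ^ N * real (card (V i))" if "i \<in> I" for i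
      proof -
        have "1 * real n \<le> (q * \<eta>) * n" using q\<eta> by (rule mult_right_mono) simp
        also have "\<dots> = q * (\<eta> * n)" by simp
        also have "\<dots> \<le> q * (2 ^ N * real (card (V i)))" using V(2)[OF that] by (rule mult_left_mono) simp
        finally show ?thesis by (simp add: mult_ac)
      qed
      then have "(\<Prod>i\<in>I. real n) \<le> (\<Prod>i\<in>I. q * 2 ^ N * real (card (V i)))" by (intro prod_mono) auto
      also have "\<dots> = (q * 2 ^ N) ^ h * vol I V" by (simp add: prod.distrib vol_def finI power_mult_distrib)
      also have "\<dots> \<le> (q * 2 ^ N) ^ h * (4 * q ^ m * 2 ^ (2 * q ^ m) * real (card X))"
        using vol by (intro mult_left_mono) (auto simp: X_def)
      finally have "real (n ^ h) \<le> real (q ^ h * 2 ^ (N * h) * (4 * q ^ m * 2 ^ (2 * q ^ m)) * card X)"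
        by (simp add: finI power_mult_distrib power_mult mult_ac)
      then show ?thesis by (simp only: of_nat_le_iff)
    qed
    \<comment> \<open>This leaves \<open>q ^ m\<close> as the only parameter besides
      \<open>N\<close>; the invariant bounds both.\<close>
    also have "\<dots> \<le> (q ^ m) ^ h * 2 ^ (N * h) * (4 * q ^ m * 2 ^ (2 * q ^ m)) * card X"
      using q m by (intro mult_le_mono1 power_mono self_le_power) auto
    finally have Xbig: "n ^ h \<le> (q ^ m) ^ h * 2 ^ (N * h) * (4 * q ^ m * 2 ^ (2 * q ^ m)) * card X" .
    have Xcopies: "card X \<le> card (copies H G) * h ^ h + h ^ 2 * n ^ (h - 1)"
    proof -
      have "card X \<le> card {x \<in> X. inj_on x I} + card {x \<in> PiE I (\<lambda>_. U). \<not> inj_on x I}"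
      proof -
        have "X \<subseteq> {x \<in> X. inj_on x I} \<union> {x \<in> PiE I (\<lambda>_. U). \<not> inj_on x I}" using XP by blast
        then have "card X \<le> card ({x \<in> X. inj_on x I} \<union> {x \<in> PiE I (\<lambda>_. U). \<not> inj_on x I})"
          using finX finI finU by (intro card_mono) (auto intro!: finite_PiE)
        then show ?thesis using card_Un_le order_trans by blast
      qed
      moreover have "card {x \<in> X. inj_on x I} \<le> card (copies H G) * h ^ h"
      proof -
        have "card {x \<in> X. inj_on x I} \<le> card (copies H G) * card (verts H) ^ card (verts H)"
        proof (rule card_injective_maps_le_copies[OF H G])
          fix x assume "x \<in> {x \<in> X. inj_on x I}"
          then have x: "x \<in> X" "inj_on x I" by auto
          have "(`) x ` edges H \<subseteq> edges G"
          proof -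
            have "{x a, x b} \<in> edges G" if "(a, b) \<in> F" for a b
              using x(1) that EG by (auto simp: X_def homs_def R_def)
            then show ?thesis unfolding oF(3) by auto
          qed
          then show "x \<in> extensional (verts H) \<and> inj_on x (verts H) \<and> x ` verts H \<subseteq> verts G \<and> (`) x ` edges H \<subseteq> edges G"
            using x XP by (auto simp: I_def U_def PiE_def)
        qed
        then show ?thesis using finI by (simp add: I_def)
      qed
      moreover have "card {x \<in> PiE I (\<lambda>_. U). \<not> inj_on x I} \<le> h ^ 2 * n ^ (h - 1)"
        using card_noninjective_maps[OF finI(1) finU(1)] by (simp add: finI finU)
      ultimately show ?thesis by linarith
    qed
    have c1: "1 \<le> card (copies H G)"
    proof -
      have "KK \<noteq> {}" using M by (auto simp: M_def)
      then have "copies H G \<noteq> {}" using KK(2) by blast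
      then show ?thesis using finite_copies[OF G, of H] by (simp add: Suc_le_eq card_gt_0_iff)
    qed
    have "n ^ h \<le> 2 ^ 2 ^ 2 ^ tower_nat (j + k) * card (copies H G)"
    proof (rule count_from_homs[OF N _ _ _ Xbig Xcopies c1])
      show "h \<le> tower_nat (j + k)" using heights(2) tower_nat_mono[of j "j + k"] by simp
      show "1 \<le> q ^ m" using q by (simp add: Suc_le_eq)
      show "0 < h" using h by simp
    qed
    \<comment> \<open>The three exponentials lost in the count are three more levels of the
      tower.\<close>
    also have "2 ^ 2 ^ 2 ^ tower_nat (j + k) = tower_nat (j + k + 3)" by (simp add: numeral_3_eq_3)
    also have "\<dots> \<le> tower_nat (nat \<lceil>8 * L\<rceil>)" using heights(3) by (rule tower_nat_mono)
    finally have "n ^ h \<le> tower_nat (nat \<lceil>8 * L\<rceil>) * card (copies H G)" by simp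
    then have "real (n ^ h) \<le> real (tower_nat (nat \<lceil>8 * L\<rceil>) * card (copies H G))" by (simp only: of_nat_le_iff)
    moreover have "inverse \<delta> = real (tower_nat (nat \<lceil>8 * L\<rceil>))"
      using \<delta> by (simp add: tower_def L_def mult.assoc)
    ultimately have le: "real n ^ h \<le> inverse \<delta> * real (card (copies H G))" by simp
    have "0 < inverse \<delta>"
      using tower_nat_ge[of "nat \<lceil>8 * L\<rceil>"] \<open>inverse \<delta> = real (tower_nat (nat \<lceil>8 * L\<rceil>))\<close> by simp
    then have "0 < \<delta>" by simp
    then have "\<delta> * real n ^ h \<le> \<delta> * (inverse \<delta> * real (card (copies H G)))"
      using le by (intro mult_left_mono) auto
    moreover have "\<delta> * (inverse \<delta> * real (card (copies H G))) = real (card (copies H G))"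
      using \<open>0 < \<delta>\<close> by (simp add: field_simps)
    ultimately show ?thesis by linarith
  qed
qed

end
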